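(* Let $\mathcal{X}$ and $\mathcal{Y}$ be Polish spaces, let $\mu_0$ be a probability measure on $\mathcal{X}$, let $\Gamma\ge 0$, and let $\mathcal{S}(\Gamma)=\{\mu\in\mathcal{M}_1(\mathcal{X}): D_{KL}(\mu\|\mu_0)\le\Gamma\}$. Let $Q$ be a conditional distribution from $\mathcal{X}$ to $\mathcal{Y}$ such that $I(X;Y)<\infty$ whenever $(X,Y)\sim\mu\otimes Q$ with $\mu\in\mathcal{S}(\Gamma)$. Then there exist a random variable $Z$ and a deterministic (measurable) function $g$ such that, for every $X\sim\mu$ with $\mu\in\mathcal{S}(\Gamma)$, $Z$ is independent of $X$, $Y$ can be expressed as $Y=g(X,Z)$ (i.e. $(X,g(X,Z))\sim\mu\otimes Q$), and $$H(Y\mid Z)\le \bar{I}(\mathcal{S}(\Gamma),Q)+\Gamma+\log\big(\bar{I}(\mathcal{S}(\Gamma),Q)+\Gamma+1\big)+4 .$$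
   Context: $\mathcal{M}_1(\mathcal{X})$ is the set of probability measures on $\mathcal{X}$ and $D_{KL}$ is the Kullback–Leibler divergence. A conditional distribution (stochastic kernel) $Q$ from $\mathcal{X}$ to $\mathcal{Y}$ is a map $x\mapsto Q(\cdot|x)$ into probability measures on $\mathcal{Y}$ with $x\mapsto Q(A|x)$ measurable for every measurable $A$. For $\mu\in\mathcal{M}_1(\mathcal{X})$, $\mu\otimes Q$ is the joint law of $(X,Y)$ with $X\sim\mu$, $Y|X=x\sim Q(\cdot|x)$; $I(\mu,Q)$ is the mutual information of this pair, and $\bar{I}(\mathcal{S},Q)=\sup_{\mu\in\mathcal{S}}I(\mu,Q)$. $H(\cdot\mid\cdot)$ is (discrete) conditional entropy; logarithms and entropies are in bits. *)

theory Defs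
  imports "HOL-Probability.Probability"
begin

text \<open>Kullback-Leibler divergence D(M||N) in bits, valued in [0,\<infinity>].
  If M is absolutely continuous w.r.t. N with density f = dM/dN, then
  D(M||N) = integral of f log2 f dN, which (for probability measures) equals the
  integral of the nonnegative function (f ln f - f + 1)/ln 2; otherwise D = \<infinity>.\<close>
definition KL_div :: "'a measure \<Rightarrow> 'a measure \<Rightarrow> ennreal" where
  "KL_div M N =
     (if absolutely_continuous N M then
        (\<integral>\<^sup>+ x. ennreal (let f = enn2real (RN_deriv N M x) in (f * ln f - f + 1) / ln 2) \<partial>N)
      else \<infinity>)"

definition joint_law :: "'a::topological_space measure \<Rightarrow> ('a \<Rightarrow> 'b::topological_space measure) \<Rightarrow> ('a \<times> 'b) measure" where
  "joint_law \<mu> Q = \<mu> \<bind> (\<lambda>x. distr (Q x) (borel \<Otimes>\<^sub>M borel) (\<lambda>y. (x, y)))"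

definition mutual_info :: "'a::topological_space measure \<Rightarrow> ('a \<Rightarrow> 'b::topological_space measure) \<Rightarrow> ennreal" where
  "mutual_info \<mu> Q = KL_div (joint_law \<mu> Q) (\<mu> \<Otimes>\<^sub>M (\<mu> \<bind> Q))"

definition KL_ball :: "'a::topological_space measure \<Rightarrow> real \<Rightarrow> 'a measure set" where
  "KL_ball \<mu>0 \<Gamma> = {\<mu>. sets \<mu> = sets borel \<and> prob_space \<mu> \<and> KL_div \<mu> \<mu>0 \<le> ennreal \<Gamma>}"

definition sup_mutual_info :: "'a::topological_space measure set \<Rightarrow> ('a \<Rightarrow> 'b::topological_space measure) \<Rightarrow> ennreal" where
  "sup_mutual_info S Q = (SUP \<mu>\<in>S. mutual_info \<mu> Q)"

definition disc_entropy :: "'b measure \<Rightarrow> ennreal" where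
  "disc_entropy \<nu> =
     (if (\<integral>\<^sup>+ y. emeasure \<nu> {y} \<partial>count_space UNIV) = 1 then
        (\<integral>\<^sup>+ y. ennreal (measure \<nu> {y} * log 2 (1 / measure \<nu> {y})) \<partial>count_space UNIV)
      else \<infinity>)"

text \<open>H(Y|Z) for Y = g(X,Z), X ~ mu, Z ~ PZ independent: the conditional law of Y given Z = z
  is the law of g(X,z), and H(Y|Z) = integral over z of its discrete entropy.\<close>
definition cond_entropy_fr :: "'a::topological_space measure \<Rightarrow> 'z measure \<Rightarrow> ('a \<Rightarrow> 'z \<Rightarrow> 'b::topological_space) \<Rightarrow> ennreal" where
  "cond_entropy_fr \<mu> PZ g = (\<integral>\<^sup>+ z. disc_entropy (distr \<mu> borel (\<lambda>x. g x z)) \<partial>PZ)"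

end

theory Submission
  imports Defs
begin

text \<open>
  Let \<open>\<nu> = \<mu>0 Q\<close> be the output law of \<open>\<mu>0\<close> and \<open>f\<close> the density of the joint law of \<open>\<mu>0\<close> with
  respect to \<open>\<mu>0 \<Otimes> \<nu>\<close>. Data processing for the output laws gives
  \<open>E D(Q(X) || \<nu>) \<le> I(\<mu>,Q) + D(\<mu> || \<mu>0)\<close> for every \<open>\<mu>\<close> absolutely continuous with respect to \<open>\<mu>0\<close>,
  so it is enough to simulate the density \<open>F = f(x,\<cdot>)\<close> relative to \<open>\<nu>\<close> at a cost of
  \<open>C + log (C + 1) + 4\<close> bits, where \<open>C\<close> bounds this average divergence.

  The common randomness is a doubly infinite array of independent pairs \<open>(Y,U)\<close> with \<open>Y \<sim> \<nu>\<close> and \<open>U\<close> uniform.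
  The region below the graph of \<open>F\<close> is cut into horizontal layers of height \<open>1\<close>. In each round (row)
  the layers are examined in order, and the acceptance thresholds are chosen such that a round accepts in layer \<open>k\<close>
  with probability exactly half the mass of that layer. So the accepted \<open>Y\<close> has law \<open>F \<nu>\<close>, the number of
  rounds is geometric with parameter \<open>1/2\<close> (\<open>2\<close> bits), and the layer \<open>k\<close> satisfies
  \<open>E log (k + 3/2) \<le> D(F \<nu> || \<nu>) + 1\<close>. Given the array, the output is a function of the cell, so its
  entropy is at most the length of a code for the cell; the weights \<open>a (k + 3/2) powr -(1 + a)\<close> with
  \<open>a = 1 / (C + 1)\<close> cost \<open>log (C + 1) + (1 + a) (C + 1) = log (C + 1) + C + 2\<close> bits for the layer.
  In contrast to the Poisson functional representation, all this takes place in discrete time.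
\<close>

section \<open>Real inequalities\<close>

lemma ln_div_ge: "x * ln (x / y) - x + y \<ge> 0" if "x > 0" "y > 0" for x y :: real
proof -
  have "ln (y / x) \<le> y / x - 1"
    using that by (intro ln_le_minus_one) simp
  then have "x * ln (y / x) \<le> x * (y / x - 1)"
    using that by (intro mult_left_mono) auto
  then show ?thesis
    using that by (simp add: ln_div algebra_simps)
qed

text \<open>The integrand of \<open>KL_div\<close> up to the factor \<open>1 / ln 2\<close>. For a
  probability density with respect to a probability measure the terms \<open>- t + 1\<close>
  integrate to 0; they make the integrand nonnegative, so that divergences can be handled entirely
  in \<open>ennreal\<close>.\<close>

definition kl_fun :: "real \<Rightarrow> real" where
  "kl_fun t = t * ln t - t + 1"

lemma kl_fun_nonneg: "0 \<le> t \<Longrightarrow> 0 \<le> kl_fun t"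
  using ln_div_ge[of t 1] by (cases "t = 0") (auto simp: kl_fun_def)

lemma kl_fun_measurable [measurable]: "kl_fun \<in> borel_measurable borel"
  unfolding kl_fun_def by measurable

text \<open>Unless an argument vanishes, the right side exceeds the left by
  \<open>f * (h * ln (h / r) - h + r)\<close>, which is nonnegative by \<open>ln_div_ge\<close>.
  With \<open>h\<close>, \<open>f\<close> and \<open>r\<close> the densities of input, joint and
  output law, this excess integrates, up to the factor \<open>ln 2\<close>, to the divergence of the
  density \<open>h * f\<close> from the density \<open>r * f\<close>: data processing in pointwise
  form. The linear terms are distributed over the two sides so that nothing is subtracted.\<close>

lemma kl_fun_chain:
  assumes "0 \<le> h" "0 \<le> f" "0 \<le> r" and "r = 0 \<Longrightarrow> h * f = 0"
  shows "h * kl_fun f + (f + h * r) \<le> h * r * kl_fun (f / r) + f * kl_fun h + (h + r * f)"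
proof (cases "h = 0 \<or> f = 0 \<or> r = 0")
  case True
  then show ?thesis
    using assms by (auto simp: kl_fun_def)
next
  case False
  then have pos: "h > 0" "f > 0" "r > 0"
    using assms by auto
  have "0 \<le> f * (h * ln (h / r) - h + r)"
    using pos ln_div_ge[of h r] by simp
  also have "\<dots> = h * r * kl_fun (f / r) + f * kl_fun h + (h + r * f) - (h * kl_fun f + (f + h * r))"
    using pos by (simp add: kl_fun_def ln_div field_simps)
  finally show ?thesis
    by simp
qed

section \<open>Slicing a nonnegative real into layers of height 1\<close>

definition layer :: "real \<Rightarrow> nat \<Rightarrow> real" where
  "layer t k = min 1 (max 0 (t - real k))"

lemma layer_nonneg [simp]: "0 \<le> layer t k" and layer_le_1 [simp]: "layer t k \<le> 1"
  by (auto simp: layer_def)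

lemma layer_measurable [measurable]: "(\<lambda>t. layer t k) \<in> borel_measurable borel"
  unfolding layer_def by measurable

lemma sum_layer: "0 \<le> t \<Longrightarrow> (\<Sum>k<n. layer t k) = min t (real n)"
  by (induction n) (auto simp: layer_def min_def max_def)

lemma layer_eq_0: "t \<le> real k \<Longrightarrow> layer t k = 0"
  by (simp add: layer_def)

lemma layer_sums: "layer t sums t" if "0 \<le> t"
proof -
  obtain n where n: "t \<le> real n"
    using real_arch_simple by blast
  have "layer t sums (\<Sum>k<n. layer t k)"
    using n by (intro sums_finite) (auto simp: layer_eq_0)
  then show ?thesis
    using n that by (simp add: sum_layer)
qed

text \<open>\<open>real k * layer t k\<close> is at most the integral of \<open>s\<close> over the
  part of \<open>[0, t]\<close> inside \<open>[k, k + 1]\<close>, and these integrals add up to at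
  most \<open>t^2 / 2\<close>.\<close>

lemma sum_mult_layer_le: "0 \<le> t \<Longrightarrow> (\<Sum>k<n. real k * layer t k) \<le> t\<^sup>2 / 2"
proof -
  assume t: "0 \<le> t"
  \<comment> \<open>The induction needs the sharper bound in terms of the height
    \<open>min t (real n)\<close> covered by the first \<open>n\<close> layers.\<close>
  have "(\<Sum>k<n. real k * layer t k) \<le> (min t (real n))\<^sup>2 / 2" for n
  proof (induction n)
    case (Suc n)
    show ?case
    proof (cases "t \<le> real n")
      case True
      then show ?thesis using Suc by (simp add: layer_eq_0 min_def split: if_splits)
    next
      case False
      define m where "m = min t (real (Suc n))"
      have m: "real n \<le> m" "layer t n = m - real n" "min t (real n) = real n"
        using False by (auto simp: m_def layer_def)
      have "real n * (m - real n) \<le> (m\<^sup>2 - (real n)\<^sup>2) / 2"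
        using zero_le_power2[of "m - real n"] by (simp add: power2_eq_square algebra_simps)
      then show ?thesis
        using Suc m unfolding m_def[symmetric] by (simp add: diff_divide_distrib)
    qed
  qed (use t in simp)
  also have "(min t (real n))\<^sup>2 / 2 \<le> t\<^sup>2 / 2"
    using t by (intro divide_right_mono power_mono) auto
  finally show ?thesis .
qed

text \<open>The tangent of \<open>ln\<close> at \<open>2 t\<close> is the right one because the average of
  \<open>k + 3/2\<close> under the weights \<open>layer t k / t\<close> is at most \<open>t / 2 + 3 / 2\<close>, and \<open>t\<close> is about \<open>1\<close> on average.\<close>
lemma sum_layer_ln_le:
  assumes "0 \<le> t"
  shows "(\<Sum>k<n. layer t k * ln (real k + 3/2)) + 1/4 \<le> kl_fun t + t * (ln 2 + 1/4)"
proof (cases "t = 0")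
  case True
  then show ?thesis by (simp add: kl_fun_def layer_def)
next
  case False
  with assms have t: "t > 0" by simp
  \<comment> \<open>All \<open>N\<close> layers together have total height exactly \<open>t\<close>,
    which is what lets the tangent bound be summed in closed form.\<close>
  obtain N where N: "t \<le> real N" "n \<le> N"
    by (meson linorder_linear order_trans of_nat_mono real_arch_simple)
  have tangent: "ln (real k + 3/2) \<le> ln (2 * t) - 1 + (real k + 3/2) / (2 * t)" for k :: nat
    using ln_le_minus_one[of "(real k + 3/2) / (2 * t)"] t by (simp add: ln_div)
  have "(\<Sum>k<n. layer t k * ln (real k + 3/2)) \<le> (\<Sum>k<N. layer t k * ln (real k + 3/2))"
    using N by (intro sum_mono2) auto
  also have "\<dots> \<le> (\<Sum>k<N. layer t k * (ln (2 * t) - 1 + (real k + 3/2) / (2 * t)))"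
    using tangent by (intro sum_mono mult_left_mono) auto
  also have "\<dots> = (ln (2 * t) - 1 + 3 / (4 * t)) * (\<Sum>k<N. layer t k) + (\<Sum>k<N. real k * layer t k) / (2 * t)"
    unfolding sum_divide_distrib sum_distrib_left sum.distrib[symmetric]
    using t by (intro sum.cong) (auto simp: field_simps)
  also have "\<dots> \<le> (ln (2 * t) - 1 + 3 / (4 * t)) * t + t\<^sup>2 / 2 / (2 * t)"
    using t N sum_mult_layer_le[of t N] by (intro add_mono divide_right_mono) (auto simp: sum_layer)
  also have "\<dots> = kl_fun t + t * (ln 2 + 1/4) - 1/4"
    using t by (simp add: kl_fun_def ln_mult field_simps power2_eq_square)
  finally show ?thesis by simp
qed

text \<open>The right side is the integral of \<open>a * x powr (- (1 + a))\<close> over the unit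
  interval centred at \<open>m\<close>. The integrand is convex, so the midpoint rule underestimates
  it; \<open>F t\<close> is the error for half-width \<open>t\<close>, shown to increase with
  \<open>t\<close>.\<close>

lemma midpoint_powr_le:
  fixes a m :: real
  assumes "a > 0" "m > 1/2"
  shows "a * m powr (- (1 + a)) \<le> (m - 1/2) powr (-a) - (m + 1/2) powr (-a)"
proof -
  define F where "F t = (m - t) powr (-a) - (m + t) powr (-a) - 2 * t * a * m powr (- (1 + a))" for t
  have "F 0 \<le> F (1/2)"
  proof (rule DERIV_nonneg_imp_nondecreasing[where f = F])
    fix t :: real assume t: "0 \<le> t" "t \<le> 1/2"
    have pos: "m - t > 0" "m + t > 0" "m > 0" using t assms by auto
    have "(F has_real_derivative a * ((m - t) powr (-a-1) + (m + t) powr (-a-1) - 2 * m powr (-(1+a)))) (at t)"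
      unfolding F_def using pos
      by (auto intro!: derivative_eq_intros simp: field_simps)
    \<comment> \<open>Midpoint convexity from the inequality of arithmetic and geometric means:
      \<open>x * y\<close> is a negative power of \<open>m^2 - t^2\<close>, hence at least the same
      power of \<open>m^2\<close>.\<close>
    moreover have "2 * m powr (-(1+a)) \<le> (m - t) powr (-a-1) + (m + t) powr (-a-1)"
    proof -
      define x where "x = (m - t) powr ((-a-1) / 2)"
      define y where "y = (m + t) powr ((-a-1) / 2)"
      have "m powr (-(1+a)) = m powr ((-a-1) / 2 + (-a-1) / 2)"
        by (rule arg_cong[where f = "(powr) m"]) simp
      also have "\<dots> = (m * m) powr ((-a-1) / 2)"
        using pos by (simp only: powr_mult powr_add)
      also have "\<dots> \<le> ((m - t) * (m + t)) powr ((-a-1) / 2)"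
        using pos assms t zero_le_power2[of t]
        by (intro powr_mono2' mult_pos_pos) (simp_all add: algebra_simps power2_eq_square)
      also have "\<dots> = x * y"
        using pos by (simp add: x_def y_def powr_mult)
      finally have "2 * m powr (-(1+a)) \<le> 2 * (x * y)" by simp
      also have "\<dots> \<le> x * x + y * y"
        using zero_le_power2[of "x - y"] by (simp add: power2_eq_square algebra_simps)
      also have "\<dots> = (m - t) powr (-a-1) + (m + t) powr (-a-1)"
        by (simp add: x_def y_def powr_add[symmetric])
      finally show ?thesis .
    qed
    ultimately show "\<exists>y. (F has_real_derivative y) (at t) \<and> y \<ge> 0"
      using assms by (intro exI conjI) (assumption, simp)
  qed simp
  then show ?thesis by (simp add: F_def)
qed

text \<open>Shifting the summation index by \<open>3 / 2\<close> makes each term smaller than the integral of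
  \<open>a x powr -(1 + a)\<close> over an interval of length \<open>1\<close> around it, so that no normalization is needed.\<close>
lemma sum_shifted_powr_le_1:
  fixes a :: real
  assumes "a > 0"
  shows "(\<Sum>k<n. a * (real k + 3/2) powr (- (1 + a))) \<le> 1"
proof -
  have "(\<Sum>k<n. a * (real k + 3/2) powr (- (1 + a))) \<le>
        (\<Sum>k<n. (real k + 1) powr (-a) - (real (Suc k) + 1) powr (-a))"
    using midpoint_powr_le[OF assms]
    by (intro sum_mono) (smt (verit, best) field_sum_of_halves of_nat_0_le_iff of_nat_Suc)
  also have "\<dots> = 1 - (real n + 1) powr (-a)"
    by (subst sum_lessThan_telescope') simp
  finally show ?thesis by (smt (verit) powr_ge_zero)
qed

text \<open>A point is determined by the members of a countable basis that contain it, hence by a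
  set of naturals. This allows the common randomness, which lives on a space of arrays, to be coded
  by real numbers.\<close>

lemma ex_inj_real: "\<exists>f :: 'a :: {second_countable_topology, t2_space} \<Rightarrow> real. inj f"
proof -
  obtain B :: "'a set set" where B: "countable B" "topological_basis B"
    using ex_countable_basis by blast
  have "inj (\<lambda>x. from_nat_into B -` {U. x \<in> U} :: nat set)"
  proof (rule injI, rule ccontr)
    fix x y assume eq: "from_nat_into B -` {U. x \<in> U} = from_nat_into B -` {U. y \<in> U}" and "x \<noteq> y"
    then obtain V where V: "open V" "x \<in> V" "y \<notin> V"
      using t1_space by blast
    obtain U where U: "U \<in> B" "x \<in> U" "U \<subseteq> V"
      using topological_basisE[OF B(2) V(1,2)] by auto
    obtain n where "from_nat_into B n = U"
      using from_nat_into_surj[OF B(1) U(1)] by auto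
    with eq U V show False
      by (auto simp: set_eq_iff)
  qed
  moreover obtain g :: "nat set \<Rightarrow> real" where "inj g"
    using eqpoll_imp_lepoll[OF nat_sets_eqpoll_reals] unfolding lepoll_def by auto
  ultimately show ?thesis
    using inj_compose by blast
qed

section \<open>Discrete entropy and cross entropy\<close>

text \<open>Pointwise Gibbs inequality, from \<open>ln x \<le> x - 1\<close>. The masses
  \<open>p / ln 2\<close> and \<open>q / ln 2\<close> stay on separate sides so that it can be
  summed without subtraction.\<close>

lemma mult_log_inverse_le:
  fixes p q :: real
  assumes "0 \<le> p" "0 < q"
  shows "p * log 2 (1 / p) + p / ln 2 \<le> p * log 2 (1 / q) + q / ln 2"
proof (cases "p = 0")
  case False
  with assms have p: "p > 0" by simp
  have "ln (q / p) \<le> q / p - 1"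
    using p assms by (intro ln_le_minus_one) simp
  then have "p * ln (q / p) \<le> p * (q / p - 1)"
    using p by (intro mult_left_mono) auto
  then have "p * ln (1 / p) + p \<le> p * ln (1 / q) + q"
    using p assms by (simp add: ln_div algebra_simps)
  then have "(p * ln (1 / p) + p) / ln 2 \<le> (p * ln (1 / q) + q) / ln 2"
    by (intro divide_right_mono) auto
  then show ?thesis
    by (simp add: log_def add_divide_distrib)
qed (use assms in simp)

text \<open>Each point mass is the integral of an indicator; after exchanging sum and integral, only
  the term \<open>y = x\<close> can survive at \<open>x\<close>.\<close>

lemma nn_integral_point_masses_le:
  fixes \<nu> :: "'b::t1_space measure"
  assumes "sets \<nu> = sets borel" "countable X"
  shows "(\<integral>\<^sup>+y. emeasure \<nu> {y} * l y \<partial>count_space X) \<le> (\<integral>\<^sup>+y. l y \<partial>\<nu>)"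
proof -
  have [measurable]: "{y} \<in> sets \<nu>" for y
    using assms by simp
  have "(\<integral>\<^sup>+y. emeasure \<nu> {y} * l y \<partial>count_space X) =
        (\<integral>\<^sup>+y. (\<integral>\<^sup>+x. l y * indicator {y} x \<partial>\<nu>) \<partial>count_space X)"
    by (intro nn_integral_cong) (simp add: nn_integral_cmult mult.commute)
  also have "\<dots> = (\<integral>\<^sup>+x. (\<integral>\<^sup>+y. l y * indicator {y} x \<partial>count_space X) \<partial>\<nu>)"
    using assms by (intro nn_integral_count_space_nn_integral[symmetric]) auto
  also have "\<dots> \<le> (\<integral>\<^sup>+x. l x \<partial>\<nu>)"
  proof (intro nn_integral_mono)
    fix x
    have "(\<integral>\<^sup>+y. l y * indicator {y} x \<partial>count_space X) =
        (\<integral>\<^sup>+y. l y * indicator {y} x * indicator X y \<partial>count_space UNIV)"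
      by (simp add: nn_integral_count_space_indicator)
    also have "\<dots> \<le> (\<integral>\<^sup>+y. l x * indicator {x} y \<partial>count_space UNIV)"
      by (intro nn_integral_mono) (auto simp: indicator_def)
    also have "\<dots> = l x"
      by (subst nn_integral_cmult) (auto simp: one_ennreal_def[symmetric])
    finally show "(\<integral>\<^sup>+y. l y * indicator {y} x \<partial>count_space X) \<le> l x" .
  qed
  finally show ?thesis .
qed

text \<open>Gibbs inequality, with a code \<kappa> that may have total mass below 1. It reduces the
  entropy bound to exhibiting one good code.\<close>

lemma disc_entropy_le_cross_entropy:
  fixes \<nu> \<kappa> :: "'b::t1_space measure"
  assumes \<nu>: "prob_space \<nu>" "sets \<nu> = sets borel"
    and \<kappa>: "sets \<kappa> = sets borel" "emeasure \<kappa> UNIV \<le> 1"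
    and X: "countable X" "AE y in \<nu>. y \<in> X" "\<And>y. y \<in> X \<Longrightarrow> measure \<kappa> {y} > 0"
  shows "disc_entropy \<nu> \<le> (\<integral>\<^sup>+y. ennreal (log 2 (1 / measure \<kappa> {y})) \<partial>\<nu>)"
proof -
  interpret \<nu>: prob_space \<nu> by fact
  have sp: "space \<nu> = UNIV" "space \<kappa> = UNIV"
    using \<nu>(2) \<kappa>(1) by (metis sets_eq_imp_space_eq space_borel)+
  interpret \<kappa>: subprob_space \<kappa>
    using \<kappa>(2) sp by (intro subprob_spaceI) auto
  have [measurable]: "{y} \<in> sets \<nu>" "{y} \<in> sets \<kappa>" for y
    using \<nu>(2) \<kappa>(1) by simp_all
  have [measurable]: "X \<in> sets \<nu>" "X \<in> sets \<kappa>"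
    using X(1) by (auto intro: sets.countable)
  have null: "emeasure \<nu> {y} = 0" if "y \<notin> X" for y
  proof -
    have "{y} \<in> null_sets \<nu>"
      using X(2) that by (subst AE_iff_null_sets) (auto elim!: eventually_mono)
    then show ?thesis by auto
  qed
  have restrict: "(\<integral>\<^sup>+y. F y \<partial>count_space UNIV) = (\<integral>\<^sup>+y. F y \<partial>count_space X)"
    if "\<And>y. y \<notin> X \<Longrightarrow> F y = 0" for F :: "'b \<Rightarrow> ennreal"
    using that by (intro nn_integral_count_space_eq) auto
  \<comment> \<open>Concentration on the countable set \<open>X\<close> selects the finite branch of
    \<open>disc_entropy\<close>.\<close>
  have one: "(\<integral>\<^sup>+y. emeasure \<nu> {y} \<partial>count_space X) = 1"
    using \<nu>.emeasure_eq_1_AE[of X] X emeasure_countable_singleton[of X \<nu>] by simp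
  have sub: "(\<integral>\<^sup>+y. emeasure \<kappa> {y} \<partial>count_space X) \<le> 1"
    using emeasure_countable_singleton[of X \<kappa>] X \<kappa>.subprob_emeasure_le_1[of X] by simp
  define p where "p y = measure \<nu> {y}" for y
  define q where "q y = measure \<kappa> {y}" for y
  have ep: "emeasure \<nu> {y} = ennreal (p y)" and eq: "emeasure \<kappa> {y} = ennreal (q y)" for y
    by (simp_all add: p_def q_def \<nu>.emeasure_eq_measure \<kappa>.emeasure_eq_measure)
  have q: "0 < q y" "q y \<le> 1" if "y \<in> X" for y
    using X(3)[OF that] \<kappa>.subprob_measure_le_1 by (auto simp: q_def)
  have p: "0 \<le> p y" "p y \<le> 1" for y
    by (auto simp: p_def)
  have plog: "0 \<le> p y * log 2 (1 / p y)" for y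
    using p[of y] by (cases "p y = 0") auto
  have "disc_entropy \<nu> = (\<integral>\<^sup>+y. ennreal (p y * log 2 (1 / p y)) \<partial>count_space UNIV)"
    using one restrict[of "\<lambda>y. emeasure \<nu> {y}"] null by (simp add: disc_entropy_def p_def)
  also have "\<dots> = (\<integral>\<^sup>+y. ennreal (p y * log 2 (1 / p y)) \<partial>count_space X)"
    using null by (intro restrict) (simp add: p_def measure_def)
  finally have H: "disc_entropy \<nu> = (\<integral>\<^sup>+y. ennreal (p y * log 2 (1 / p y)) \<partial>count_space X)" .
  \<comment> \<open>The constant \<open>1 / ln 2\<close> is the total of the terms
    \<open>p / ln 2\<close>. The corresponding total for \<kappa> is at most the same constant,
    which is finite and can be cancelled at the end.\<close>
  have "disc_entropy \<nu> + ennreal (1 / ln 2) =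
      (\<integral>\<^sup>+y. ennreal (p y * log 2 (1 / p y)) + emeasure \<nu> {y} * ennreal (1 / ln 2) \<partial>count_space X)"
    by (simp add: H nn_integral_add nn_integral_multc one)
  also have "\<dots> \<le> (\<integral>\<^sup>+y. emeasure \<nu> {y} * ennreal (log 2 (1 / q y)) + emeasure \<kappa> {y} * ennreal (1 / ln 2) \<partial>count_space X)"
  proof (intro nn_integral_mono)
    fix y assume "y \<in> space (count_space X)"
    then have y: "0 < q y" "q y \<le> 1" using q by auto
    then have "0 \<le> log 2 (1 / q y)" by simp
    then show "ennreal (p y * log 2 (1 / p y)) + emeasure \<nu> {y} * ennreal (1 / ln 2)
          \<le> emeasure \<nu> {y} * ennreal (log 2 (1 / q y)) + emeasure \<kappa> {y} * ennreal (1 / ln 2)"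
      using mult_log_inverse_le[OF p(1) y(1)] p[of y] y plog[of y] unfolding ep eq
      by (simp add: ennreal_mult[symmetric] ennreal_plus[symmetric] ennreal_leI del: ennreal_plus)
  qed
  also have "\<dots> = (\<integral>\<^sup>+y. emeasure \<nu> {y} * ennreal (log 2 (1 / q y)) \<partial>count_space X)
        + (\<integral>\<^sup>+y. emeasure \<kappa> {y} \<partial>count_space X) * ennreal (1 / ln 2)"
    by (simp add: nn_integral_add nn_integral_multc)
  also have "\<dots> \<le> (\<integral>\<^sup>+y. ennreal (log 2 (1 / q y)) \<partial>\<nu>) + 1 * ennreal (1 / ln 2)"
    using \<nu>(2) X(1) sub by (intro add_mono mult_right_mono nn_integral_point_masses_le) auto
  finally show ?thesis
    unfolding q_def by (simp add: ennreal_add_left_cancel_le add.commute[of _ "ennreal (1 / ln 2)"])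
qed

section \<open>Layered rejection sampling\<close>

lemma nn_integral_count_space_nat_product:
  fixes f g :: "nat \<Rightarrow> ennreal"
  shows "(\<integral>\<^sup>+c. f (fst c) * g (snd c) \<partial>count_space UNIV) = (\<Sum>n. f n) * (\<Sum>k. g k)"
  unfolding nn_integral_fst_count_space[symmetric] nn_integral_count_space_nat fst_conv snd_conv
    ennreal_suminf_cmult ennreal_suminf_multc ..

lemma suminf_half_powers: "(\<Sum>n. ennreal ((1/2) ^ Suc n)) = 1"
proof -
  have "(\<Sum>n. ennreal ((1/2) ^ Suc n)) = ennreal 1"
    by (rule suminf_ennreal_eq[OF _ power_half_series]) (rule zero_le_power, simp)
  then show ?thesis by (simp only: ennreal_1)
qed

text \<open>Used at two levels: for the layers within a round and for the rounds within the array.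
  The event is a cylinder over the coordinates up to \<open>i\<close>. The success event
  \<open>B\<close> is independent of the family \<open>A\<close>, so that it can also record where
  the accepted point lies.\<close>

lemma first_success:
  fixes A :: "nat \<Rightarrow> 'a set"
  assumes "prob_space M" and [measurable]: "\<And>j. A j \<in> sets M" "B \<in> sets M"
  defines "P \<equiv> PiM (UNIV :: nat set) (\<lambda>_. M)"
  shows "measure P {w \<in> space P. (\<forall>j<i. w j \<notin> A j) \<and> w i \<in> B} =
         (\<Prod>j<i. 1 - measure M (A j)) * measure M B"
proof -
  interpret M: prob_space M by fact
  interpret P: product_prob_space "\<lambda>_. M" "UNIV :: nat set" ..
  define X where "X j = (if j = i then B else space M - A j)" for j
  have [measurable]: "X j \<in> sets M" for j by (simp add: X_def)
  have "{w \<in> space P. (\<forall>j<i. w j \<notin> A j) \<and> w i \<in> B} = {w \<in> space P. \<forall>j\<in>{..i}. w j \<in> X j}"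
    by (auto simp: X_def P_def space_PiM PiE_iff le_less)
  then have "emeasure P {w \<in> space P. (\<forall>j<i. w j \<notin> A j) \<and> w i \<in> B} = (\<Prod>j\<in>{..i}. emeasure M (X j))"
    unfolding P_def by (simp add: P.emeasure_PiM_Collect)
  then have "measure P {w \<in> space P. (\<forall>j<i. w j \<notin> A j) \<and> w i \<in> B} = (\<Prod>j\<in>{..i}. measure M (X j))"
    by (intro measure_eq_emeasure_eq_ennreal prod_nonneg)
       (simp_all add: M.emeasure_eq_measure prod_ennreal)
  also have "\<dots> = (\<Prod>j<i. 1 - measure M (A j)) * measure M B"
    unfolding lessThan_Suc_atMost[symmetric] by (simp add: X_def M.prob_compl)
  finally show ?thesis .
qed

abbreviation unit_uniform :: "real measure" where
  "unit_uniform \<equiv> uniform_measure lborel {0..1}"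

lemma sets_unit_uniform: "sets unit_uniform = sets borel"
  by simp

lemma prob_space_unit_uniform: "prob_space unit_uniform"
  by (rule prob_space_uniform_measure) simp_all

lemma emeasure_unit_uniform_mult_less:
  assumes "0 \<le> t" "t \<le> c" "0 < c"
  shows "emeasure unit_uniform {u. u * c < t} = ennreal (t / c)"
proof -
  have "{0..1} \<inter> {u. u * c < t} = {0..<t / c}"
  proof (intro set_eqI iffI)
    fix u assume "u \<in> {0..1} \<inter> {u. u * c < t}"
    then show "u \<in> {0..<t / c}"
      using assms by (simp add: pos_less_divide_eq)
  next
    fix u assume u: "u \<in> {0..<t / c}"
    then have "u * c < t"
      using assms by (simp add: pos_less_divide_eq)
    moreover have "u < 1"
      using u assms by (auto intro: less_le_trans)
    ultimately show "u \<in> {0..1} \<inter> {u. u * c < t}"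
      using u by simp
  qed
  then have "emeasure unit_uniform {u. u * c < t} = ennreal (t / c) / ennreal 1"
    using assms by simp
  also have "\<dots> = ennreal (t / c / 1)"
    using assms by (intro divide_ennreal) auto
  finally show ?thesis
    by (simp only: div_by_1)
qed

section \<open>The array of cells and the first accepting cell\<close>

definition layer_mass :: "'b measure \<Rightarrow> ('b \<Rightarrow> real) \<Rightarrow> 'b set \<Rightarrow> nat \<Rightarrow> real" where
  "layer_mass \<nu> F B k = (\<integral>y. indicator B y * layer (F y) k \<partial>\<nu>)"

text \<open>A round examines the layers in order. Layer \<open>k\<close> accepts with probability \<open>layer_mass k / (2 slack k)\<close>
  once it is reached, and it is reached with probability \<open>slack k\<close>.\<close>
definition slack :: "'b measure \<Rightarrow> ('b \<Rightarrow> real) \<Rightarrow> nat \<Rightarrow> real" where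
  "slack \<nu> F k = 1 - (\<Sum>j<k. layer_mass \<nu> F UNIV j) / 2"

text \<open>The cross-multiplied form of comparing the uniform variable with
  \<open>layer (F y) k / (2 * slack \<nu> F k)\<close>. By \<open>slack_ge\<close> this threshold
  lies between 0 and 1 when \<open>F\<close> is a probability density.\<close>

definition accepts :: "'b measure \<Rightarrow> ('b \<Rightarrow> real) \<Rightarrow> nat \<Rightarrow> 'b \<times> real \<Rightarrow> bool" where
  "accepts \<nu> F k p \<longleftrightarrow> snd p * (2 * slack \<nu> F k) < layer (F (fst p)) k"

text \<open>If no cell accepts, which has probability \<open>0\<close> by \<open>AE_first_at\<close>, then \<open>LEAST\<close> yields an arbitrary cell.\<close>
definition first_cell :: "'b measure \<Rightarrow> ('b \<Rightarrow> real) \<Rightarrow> (nat \<Rightarrow> nat \<Rightarrow> 'b \<times> real) \<Rightarrow> nat \<times> nat" where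
  "first_cell \<nu> F w = (let n = LEAST n. \<exists>k. accepts \<nu> F k (w n k) in (n, LEAST k. accepts \<nu> F k (w n k)))"

text \<open>Unlike an equation for \<open>first_cell\<close>, this event excludes the arbitrary
  value of \<open>LEAST\<close>, and it has the shape of \<open>first_success\<close> at both
  levels.\<close>

definition first_at :: "'b measure \<Rightarrow> ('b \<Rightarrow> real) \<Rightarrow> nat \<times> nat \<Rightarrow> (nat \<Rightarrow> nat \<Rightarrow> 'b \<times> real) \<Rightarrow> bool" where
  "first_at \<nu> F c w \<longleftrightarrow> (\<forall>m<fst c. \<not> (\<exists>k. accepts \<nu> F k (w m k))) \<and>
     (\<forall>j<snd c. \<not> accepts \<nu> F j (w (fst c) j)) \<and> accepts \<nu> F (snd c) (w (fst c) (snd c))"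

definition point_at :: "(nat \<Rightarrow> nat \<Rightarrow> 'b \<times> real) \<Rightarrow> nat \<times> nat \<Rightarrow> 'b" where
  "point_at w c = fst (w (fst c) (snd c))"

definition round_space :: "'b measure \<Rightarrow> (nat \<Rightarrow> 'b \<times> real) measure" where
  "round_space \<nu> = PiM UNIV (\<lambda>_. \<nu> \<Otimes>\<^sub>M unit_uniform)"

definition sample_space :: "'b measure \<Rightarrow> (nat \<Rightarrow> nat \<Rightarrow> 'b \<times> real) measure" where
  "sample_space \<nu> = PiM UNIV (\<lambda>_. round_space \<nu>)"

section \<open>Joint measurability of the sampler in the input and the array\<close>

locale layer_space = \<nu>: prob_space \<nu> for \<nu> :: "'b::topological_space measure" +
  assumes sets_\<nu> [measurable_cong]: "sets \<nu> = sets borel"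
begin

lemma space_\<nu> [simp]: "space \<nu> = UNIV"
  using sets_eq_imp_space_eq[OF sets_\<nu>] by simp

abbreviation "cell_space \<equiv> \<nu> \<Otimes>\<^sub>M unit_uniform"

sublocale U: prob_space unit_uniform by (rule prob_space_unit_uniform)
sublocale C: prob_space cell_space
  by (rule prob_space_pair) unfold_locales
sublocale R: product_prob_space "\<lambda>_. cell_space" "UNIV :: nat set" ..
sublocale R': prob_space "round_space \<nu>"
  unfolding round_space_def by (rule R.prob_space_axioms)
sublocale S: product_prob_space "\<lambda>_. round_space \<nu>" "UNIV :: nat set" ..
sublocale S': prob_space "sample_space \<nu>"
  unfolding sample_space_def by (rule S.prob_space_axioms)

lemma space_round [simp]: "space (round_space \<nu>) = UNIV"
  by (auto simp: round_space_def space_PiM space_pair_measure PiE_iff)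

lemma space_sample [simp]: "space (sample_space \<nu>) = UNIV"
  by (auto simp: sample_space_def space_PiM PiE_iff)

lemma measurable_round_component [measurable]:
  "(\<lambda>w. w k) \<in> round_space \<nu> \<rightarrow>\<^sub>M cell_space"
  unfolding round_space_def by measurable

lemma measurable_sample_component [measurable]:
  "(\<lambda>w. w n) \<in> sample_space \<nu> \<rightarrow>\<^sub>M round_space \<nu>"
  unfolding sample_space_def by measurable

lemma round_fst_measurable [measurable]: "(\<lambda>w. fst (w k)) \<in> round_space \<nu> \<rightarrow>\<^sub>M borel"
  using measurable_compose[OF measurable_round_component measurable_fst]
  unfolding measurable_cong_sets[OF refl sets_\<nu>] .

lemma round_snd_measurable [measurable]: "(\<lambda>w. snd (w k)) \<in> round_space \<nu> \<rightarrow>\<^sub>M borel"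
  using measurable_compose[OF measurable_round_component measurable_snd]
  unfolding measurable_cong_sets[OF refl sets_unit_uniform] .

lemma point_at_measurable [measurable]: "(\<lambda>w. point_at w c) \<in> sample_space \<nu> \<rightarrow>\<^sub>M borel"
  using measurable_compose[OF measurable_sample_component round_fst_measurable]
  by (simp only: point_at_def)

lemma threshold_at_measurable [measurable]: "(\<lambda>w. snd (w n k)) \<in> sample_space \<nu> \<rightarrow>\<^sub>M borel"
  by (rule measurable_compose[OF measurable_sample_component round_snd_measurable])

lemma layer_mass_measurable:
  assumes [measurable]: "(\<lambda>(x, y). f x y) \<in> borel_measurable (N \<Otimes>\<^sub>M borel)"
  shows "(\<lambda>x. layer_mass \<nu> (f x) UNIV k) \<in> borel_measurable N"
  unfolding layer_mass_def by measurable

text \<open>The input enters twice: through the density at the candidate point and, through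
  \<open>slack\<close>, in the threshold.\<close>

lemma accepts_measurable2:
  assumes [measurable]: "(\<lambda>(x, y). f x y) \<in> borel_measurable (N \<Otimes>\<^sub>M borel)"
  shows "Measurable.pred (N \<Otimes>\<^sub>M sample_space \<nu>) (\<lambda>(x, w). accepts \<nu> (f x) k (w n k))"
proof -
  note layer_mass_measurable[OF assms, measurable]
  have [measurable]: "(\<lambda>w. fst (w n k)) \<in> sample_space \<nu> \<rightarrow>\<^sub>M borel"
    by (rule measurable_compose[OF measurable_sample_component round_fst_measurable])
  have [measurable]: "(\<lambda>p. f (fst p) (fst (snd p n k))) \<in> borel_measurable (N \<Otimes>\<^sub>M sample_space \<nu>)"
    using measurable_compose[OF _ assms, of "\<lambda>p. (fst p, fst (snd p n k))" "N \<Otimes>\<^sub>M sample_space \<nu>"]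
    by simp
  show ?thesis
    unfolding accepts_def slack_def split_beta' by measurable
qed

lemma first_cell_measurable:
  assumes "(\<lambda>(x, y). f x y) \<in> borel_measurable (N \<Otimes>\<^sub>M borel)"
  shows "(\<lambda>(x, w). first_cell \<nu> (f x) w) \<in> N \<Otimes>\<^sub>M sample_space \<nu> \<rightarrow>\<^sub>M count_space UNIV"
proof -
  note accepts_measurable2[OF assms, unfolded split_beta', measurable]
  define round :: "_ \<Rightarrow> nat" where "round p = (LEAST n. \<exists>k. accepts \<nu> (f (fst p)) k (snd p n k))" for p
  have [measurable]: "round \<in> N \<Otimes>\<^sub>M sample_space \<nu> \<rightarrow>\<^sub>M count_space UNIV"
    unfolding round_def by measurable
  \<comment> \<open>The round takes countably many values, so the layer can be treated for each
    fixed round separately.\<close>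
  have "(\<lambda>p. (\<lambda>n p. (n, LEAST k. accepts \<nu> (f (fst p)) k (snd p n k))) (round p) p)
      \<in> N \<Otimes>\<^sub>M sample_space \<nu> \<rightarrow>\<^sub>M count_space UNIV"
    by (rule measurable_compose_countable) measurable
  then show ?thesis
    by (simp add: first_cell_def round_def split_beta' Let_def)
qed

lemma point_at_first_cell_measurable:
  assumes "(\<lambda>(x, y). f x y) \<in> borel_measurable (N \<Otimes>\<^sub>M borel)"
  shows "(\<lambda>(x, w). point_at w (first_cell \<nu> (f x) w)) \<in> N \<Otimes>\<^sub>M sample_space \<nu> \<rightarrow>\<^sub>M borel"
proof -
  note first_cell_measurable[OF assms, unfolded split_beta', measurable]
  have "(\<lambda>p. (\<lambda>c p. point_at (snd p) c) (first_cell \<nu> (f (fst p)) (snd p)) p)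
      \<in> N \<Otimes>\<^sub>M sample_space \<nu> \<rightarrow>\<^sub>M borel"
    by (rule measurable_compose_countable) measurable
  then show ?thesis by (simp add: split_beta')
qed

end

section \<open>Law of the accepted cell and point for a fixed density\<close>

locale layered_sampler = layer_space \<nu> for \<nu> :: "'b::topological_space measure" +
  fixes F :: "'b \<Rightarrow> real"
  assumes F_meas [measurable]: "F \<in> borel_measurable borel"
    and F_nonneg: "0 \<le> F y"
    and F_density: "(\<integral>\<^sup>+y. ennreal (F y) \<partial>\<nu>) = 1"
begin

lemma ennreal_layer_mass:
  assumes [measurable]: "B \<in> sets borel"
  shows "ennreal (layer_mass \<nu> F B k) = (\<integral>\<^sup>+y. ennreal (layer (F y) k) * indicator B y \<partial>\<nu>)"
proof -
  have "integrable \<nu> (\<lambda>y. indicator B y * layer (F y) k)"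
    by (rule \<nu>.integrable_const_bound[where B = 1]) (auto split: split_indicator)
  then have "ennreal (layer_mass \<nu> F B k) = (\<integral>\<^sup>+y. ennreal (indicator B y * layer (F y) k) \<partial>\<nu>)"
    unfolding layer_mass_def by (intro nn_integral_eq_integral[symmetric]) auto
  also have "\<dots> = (\<integral>\<^sup>+y. ennreal (layer (F y) k) * indicator B y \<partial>\<nu>)"
    by (intro nn_integral_cong) (auto split: split_indicator)
  finally show ?thesis .
qed

text \<open>The layers stack up to the whole region below the graph; this is why the masses of the
  layers over \<open>B\<close> recover the target law of \<open>B\<close>.\<close>

lemma suminf_layer_mass:
  assumes [measurable]: "B \<in> sets borel"
  shows "(\<Sum>k. ennreal (layer_mass \<nu> F B k)) = (\<integral>\<^sup>+y. ennreal (F y) * indicator B y \<partial>\<nu>)"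
proof -
  have "(\<Sum>k. ennreal (layer_mass \<nu> F B k)) = (\<integral>\<^sup>+y. (\<Sum>k. ennreal (layer (F y) k) * indicator B y) \<partial>\<nu>)"
    unfolding ennreal_layer_mass[OF assms] by (rule nn_integral_suminf[symmetric]) measurable
  also have "\<dots> = (\<integral>\<^sup>+y. ennreal (F y) * indicator B y \<partial>\<nu>)"
  proof (intro nn_integral_cong)
    fix y
    have "(\<Sum>k. ennreal (layer (F y) k)) = ennreal (F y)"
      by (intro suminf_ennreal_eq layer_sums F_nonneg) simp
    then show "(\<Sum>k. ennreal (layer (F y) k) * indicator B y) = ennreal (F y) * indicator B y"
      by simp
  qed
  finally show ?thesis .
qed

lemma suminf_layer_mass_UNIV: "(\<Sum>k. ennreal (layer_mass \<nu> F UNIV k)) = 1"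
  by (subst suminf_layer_mass) (simp_all add: F_density)

lemma layer_mass_nonneg [simp]: "0 \<le> layer_mass \<nu> F B k"
  unfolding layer_mass_def by (intro integral_nonneg_AE) auto

lemma sum_layer_mass_le_1: "(\<Sum>j<k. layer_mass \<nu> F UNIV j) \<le> 1"
proof -
  have "ennreal (\<Sum>j<k. layer_mass \<nu> F UNIV j) = (\<Sum>j<k. ennreal (layer_mass \<nu> F UNIV j))"
    by (rule sum_ennreal[symmetric]) simp
  also have "\<dots> \<le> (\<Sum>j. ennreal (layer_mass \<nu> F UNIV j))"
    by (rule sum_le_suminf) simp_all
  also have "\<dots> = ennreal 1"
    by (simp only: suminf_layer_mass_UNIV ennreal_1)
  finally show ?thesis
    by (subst (asm) ennreal_le_iff) simp_all
qed

text \<open>Halving the masses keeps the probability of reaching a layer away from 0. Hence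
  \<open>2 * slack\<close> is at least 1, the maximal height of a layer.\<close>

lemma slack_ge: "1 / 2 \<le> slack \<nu> F k"
  unfolding slack_def using sum_layer_mass_le_1[of k] by linarith

lemma accepts_measurable [measurable]: "Measurable.pred cell_space (accepts \<nu> F k)"
  unfolding accepts_def by measurable

lemma round_accepts_measurable [measurable]: "Measurable.pred (round_space \<nu>) (\<lambda>w. accepts \<nu> F k (w k'))"
  by (rule measurable_compose[OF measurable_round_component accepts_measurable])

lemma measure_accepts:
  assumes [measurable]: "B \<in> sets borel"
  shows "measure cell_space {p \<in> space cell_space. accepts \<nu> F k p \<and> fst p \<in> B} =
     layer_mass \<nu> F B k / (2 * slack \<nu> F k)"
proof -
  define c where "c = 2 * slack \<nu> F k"
  have c: "1 \<le> c"
    unfolding c_def using slack_ge[of k] by linarith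
  define A where "A = {p \<in> space cell_space. accepts \<nu> F k p \<and> fst p \<in> B}"
  have [measurable]: "A \<in> sets cell_space" unfolding A_def by measurable
  have "emeasure cell_space A = (\<integral>\<^sup>+y. emeasure unit_uniform (Pair y -` A) \<partial>\<nu>)"
    by (rule U.emeasure_pair_measure_alt) fact
  also have "\<dots> = (\<integral>\<^sup>+y. ennreal (indicator B y * layer (F y) k / c) \<partial>\<nu>)"
  proof (intro nn_integral_cong)
    fix y
    have "Pair y -` A = (if y \<in> B then {u. u * c < layer (F y) k} else {})"
      by (auto simp: A_def accepts_def space_pair_measure c_def)
    then show "emeasure unit_uniform (Pair y -` A) = ennreal (indicator B y * layer (F y) k / c)"
      using c layer_le_1[of "F y" k] by (auto simp: emeasure_unit_uniform_mult_less simp del: layer_le_1 emeasure_uniform_measure)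
  qed
  also have "\<dots> = ennreal (\<integral>y. indicator B y * layer (F y) k / c \<partial>\<nu>)"
  proof (rule nn_integral_eq_integral)
    have "norm (indicator B y * layer (F y) k / c) \<le> 1" for y
      using c layer_le_1[of "F y" k] layer_nonneg[of "F y" k]
      by (simp add: indicator_def divide_le_eq_1 del: layer_le_1)
    then show "integrable \<nu> (\<lambda>y. indicator B y * layer (F y) k / c)"
      by (intro \<nu>.integrable_const_bound[where B = 1] AE_I2) simp_all
  qed (use c in simp)
  finally have "measure cell_space A = (\<integral>y. indicator B y * layer (F y) k / c \<partial>\<nu>)"
    using c by (intro measure_eq_emeasure_eq_ennreal Bochner_Integration.integral_nonneg) simp_all
  also have "\<dots> = layer_mass \<nu> F B k / c"
    unfolding layer_mass_def by (rule integral_divide_zero)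
  finally show ?thesis
    unfolding A_def c_def .
qed

text \<open>The rejection probability of layer \<open>j\<close> is
  \<open>slack (j + 1) / slack j\<close>. The product over the layers below \<open>k\<close>
  telescopes to \<open>slack k\<close>, which cancels against the threshold of layer
  \<open>k\<close>.\<close>

lemma measure_round:
  assumes [measurable]: "B \<in> sets borel"
  shows "measure (round_space \<nu>) {w. (\<forall>j<k. \<not> accepts \<nu> F j (w j)) \<and> accepts \<nu> F k (w k) \<and> fst (w k) \<in> B} =
     layer_mass \<nu> F B k / 2"
proof -
  have slack_pos: "slack \<nu> F j > 0" for j using slack_ge[of j] by linarith
  have A: "{p \<in> space cell_space. accepts \<nu> F j p} \<in> sets cell_space" for j
    by measurable
  have B: "{p \<in> space cell_space. accepts \<nu> F k p \<and> fst p \<in> B} \<in> sets cell_space"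
    by measurable
  have "measure (round_space \<nu>) {w. (\<forall>j<k. \<not> accepts \<nu> F j (w j)) \<and> accepts \<nu> F k (w k) \<and> fst (w k) \<in> B} =
     (\<Prod>j<k. 1 - layer_mass \<nu> F UNIV j / (2 * slack \<nu> F j)) * (layer_mass \<nu> F B k / (2 * slack \<nu> F k))"
    using first_success[OF C.prob_space_axioms A B, of k]
    unfolding round_space_def[symmetric] measure_accepts[OF assms] measure_accepts[of UNIV, simplified]
    by (simp add: space_pair_measure)
  also have "(\<Prod>j<k. 1 - layer_mass \<nu> F UNIV j / (2 * slack \<nu> F j)) = slack \<nu> F k"
  proof (induction k)
    case (Suc k)
    then show ?case using slack_pos[of k] by (simp add: field_simps) (simp add: slack_def field_simps)
  qed (simp add: slack_def)
  finally show ?thesis using slack_pos[of k] by simp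
qed

text \<open>Splitting by the first accepting layer gives half of the total mass 1.\<close>

lemma measure_round_accepts: "measure (round_space \<nu>) {w. \<exists>k. accepts \<nu> F k (w k)} = 1 / 2"
proof -
  define A where "A k = {w. (\<forall>j<k. \<not> accepts \<nu> F j (w j)) \<and> accepts \<nu> F k (w k) \<and> fst (w k) \<in> UNIV}" for k
  have A: "A k = {w \<in> space (round_space \<nu>). (\<forall>j<k. \<not> accepts \<nu> F j (w j)) \<and> accepts \<nu> F k (w k)}" for k
    by (simp add: A_def)
  have [measurable]: "A k \<in> sets (round_space \<nu>)" for k
    unfolding A by measurable
  have "disjoint_family A"
    by (auto simp: disjoint_family_on_def A_def) (metis nat_neq_iff)
  moreover have "{w. \<exists>k. accepts \<nu> F k (w k)} = (\<Union>k. A k)"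
    using exists_least_iff[of "\<lambda>k. accepts \<nu> F k (w k)" for w] by (auto simp: A_def)
  ultimately have "emeasure (round_space \<nu>) {w. \<exists>k. accepts \<nu> F k (w k)} = (\<Sum>k. emeasure (round_space \<nu>) (A k))"
    by (simp add: suminf_emeasure image_subset_iff)
  also have "\<dots> = (\<Sum>k. ennreal (layer_mass \<nu> F UNIV k) * ennreal (1 / 2))"
    unfolding A_def R'.emeasure_eq_measure measure_round[of UNIV, OF sets.top[of borel, unfolded space_borel]]
    by (intro suminf_cong, subst ennreal_mult[symmetric]) simp_all
  also have "\<dots> = ennreal (1 / 2)"
    by (simp only: ennreal_suminf_multc suminf_layer_mass_UNIV mult_1)
  finally show ?thesis by (rule measure_eq_emeasure_eq_ennreal[rotated]) simp
qed

lemma accepts_at_measurable [measurable]: "Measurable.pred (sample_space \<nu>) (\<lambda>w. accepts \<nu> F k (w n k'))"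
  by (rule measurable_compose[OF measurable_sample_component round_accepts_measurable])

lemma first_cell_law_measurable [measurable]: "first_cell \<nu> F \<in> sample_space \<nu> \<rightarrow>\<^sub>M count_space UNIV"
  using measurable_compose[OF measurable_Pair1'[of "()" "count_space UNIV" "sample_space \<nu>"]
     first_cell_measurable[of "\<lambda>_. F" "count_space UNIV"]] by simp

lemma first_at_measurable [measurable]: "Measurable.pred (sample_space \<nu>) (first_at \<nu> F c)"
  unfolding first_at_def by measurable

lemma first_cell_eqI: "first_at \<nu> F c w \<Longrightarrow> first_cell \<nu> F w = c"
proof -
  assume c: "first_at \<nu> F c w"
  have "(LEAST n. \<exists>k. accepts \<nu> F k (w n k)) = fst c"
    using c unfolding first_at_def by (intro Least_equality) (blast, meson not_less)
  moreover have "(LEAST k. accepts \<nu> F k (w (fst c) k)) = snd c"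
    using c unfolding first_at_def by (intro Least_equality) (blast, meson not_less)
  ultimately show ?thesis
    by (simp add: first_cell_def Let_def)
qed

text \<open>Each earlier round rejects with probability \<open>1 / 2\<close>, and the
  \<open>1 / 2\<close> of \<open>measure_round\<close> supplies the exponent \<open>Suc\<close>. The
  product form shows that the round is independent of the layer and of the accepted point.\<close>

lemma emeasure_first_at:
  assumes [measurable]: "B \<in> sets borel"
  shows "emeasure (sample_space \<nu>) {w. first_at \<nu> F c w \<and> point_at w c \<in> B} =
     ennreal ((1/2) ^ Suc (fst c)) * ennreal (layer_mass \<nu> F B (snd c))"
proof -
  let ?k = "snd c"
  let ?A = "{w \<in> space (round_space \<nu>). \<exists>k. accepts \<nu> F k (w k)}"
  let ?B = "{w \<in> space (round_space \<nu>). (\<forall>j<?k. \<not> accepts \<nu> F j (w j)) \<and> accepts \<nu> F ?k (w ?k) \<and> fst (w ?k) \<in> B}"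
  have A: "?A \<in> sets (round_space \<nu>)"
    by measurable
  have "{w \<in> space (round_space \<nu>). fst (w ?k) \<in> B} \<in> sets (round_space \<nu>)"
    by (rule measurable_sets_Collect[OF round_fst_measurable]) simp_all
  then have B: "?B \<in> sets (round_space \<nu>)"
    by (intro sets.sets_Collect_conj sets.sets_Collect_countable_All) measurable
  have "measure (sample_space \<nu>) {w. first_at \<nu> F c w \<and> point_at w c \<in> B} =
      (\<Prod>j<fst c. 1 - 1 / 2) * (layer_mass \<nu> F B ?k / 2)"
    using first_success[OF R'.prob_space_axioms A B, of "fst c"]
    unfolding sample_space_def[symmetric]
    by (simp add: measure_round[OF assms] measure_round_accepts point_at_def first_at_def conj_assoc)
  also have "\<dots> = (1/2) ^ Suc (fst c) * layer_mass \<nu> F B ?k"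
    by simp
  finally show ?thesis
    unfolding S'.emeasure_eq_measure by (subst ennreal_mult[symmetric]) (simp_all only: zero_le_power layer_mass_nonneg zero_le_divide_1_iff zero_le_numeral)
qed

text \<open>Termination follows by adding up: the events for different cells are disjoint and their
  probabilities sum to 1.\<close>

lemma AE_first_at: "AE w in sample_space \<nu>. \<exists>c. first_at \<nu> F c w"
proof -
  define E where "E c = {w \<in> space (sample_space \<nu>). first_at \<nu> F c w}" for c
  have E [measurable]: "E c \<in> sets (sample_space \<nu>)" for c
    unfolding E_def by measurable
  have "disjoint_family E"
    unfolding disjoint_family_on_def E_def by (auto dest!: first_cell_eqI)
  then have "emeasure (sample_space \<nu>) (\<Union>c. E c) = (\<integral>\<^sup>+c. emeasure (sample_space \<nu>) (E c) \<partial>count_space UNIV)"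
    by (intro emeasure_UN_countable E) simp_all
  also have "\<dots> = (\<integral>\<^sup>+c. ennreal ((1/2) ^ Suc (fst c)) * ennreal (layer_mass \<nu> F UNIV (snd c)) \<partial>count_space UNIV)"
  proof (intro nn_integral_cong)
    fix c
    show "emeasure (sample_space \<nu>) (E c) = ennreal ((1/2) ^ Suc (fst c)) * ennreal (layer_mass \<nu> F UNIV (snd c))"
      unfolding emeasure_first_at[of UNIV, OF sets.top[of borel, unfolded space_borel], symmetric] E_def
      by simp
  qed
  also have "\<dots> = 1"
    unfolding nn_integral_count_space_nat_product[of "\<lambda>n. ennreal ((1/2) ^ Suc n)" "\<lambda>k. ennreal (layer_mass \<nu> F UNIV k)"]
      suminf_layer_mass_UNIV suminf_half_powers by simp
  finally have "AE w in sample_space \<nu>. w \<in> (\<Union>c. E c)"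
    by (intro S'.AE_in_set_eq_1[THEN iffD2]) (simp_all add: measure_eq_emeasure_eq_ennreal[of 1])
  then show ?thesis
    by (rule eventually_mono) (auto simp: E_def)
qed

lemma emeasure_first_cell:
  assumes [measurable]: "B \<in> sets borel"
  shows "emeasure (sample_space \<nu>) {w. first_cell \<nu> F w = c \<and> point_at w c \<in> B} =
     ennreal ((1/2) ^ Suc (fst c)) * ennreal (layer_mass \<nu> F B (snd c))"
proof -
  have point: "{w \<in> space (sample_space \<nu>). point_at w c \<in> B} \<in> sets (sample_space \<nu>)"
    by (rule measurable_sets_Collect[OF point_at_measurable]) simp_all
  have "{w \<in> space (sample_space \<nu>). first_cell \<nu> F w = c} \<in> sets (sample_space \<nu>)"
       "{w \<in> space (sample_space \<nu>). first_at \<nu> F c w} \<in> sets (sample_space \<nu>)"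
    by measurable
  with point have "{w \<in> space (sample_space \<nu>). first_cell \<nu> F w = c \<and> point_at w c \<in> B} \<in> sets (sample_space \<nu>)"
       "{w \<in> space (sample_space \<nu>). first_at \<nu> F c w \<and> point_at w c \<in> B} \<in> sets (sample_space \<nu>)"
    by (simp_all add: Collect_conj_eq sets.Int)
  moreover have "AE w in sample_space \<nu>. first_cell \<nu> F w = c \<and> point_at w c \<in> B \<longleftrightarrow> first_at \<nu> F c w \<and> point_at w c \<in> B"
    using AE_first_at by eventually_elim (metis first_cell_eqI)
  ultimately have "emeasure (sample_space \<nu>) {w. first_cell \<nu> F w = c \<and> point_at w c \<in> B} =
      emeasure (sample_space \<nu>) {w. first_at \<nu> F c w \<and> point_at w c \<in> B}"
    by (intro emeasure_eq_AE) (auto elim: eventually_mono)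
  then show ?thesis
    unfolding emeasure_first_at[OF assms] .
qed

lemma emeasure_first_cell_eq:
  "emeasure (sample_space \<nu>) {w. first_cell \<nu> F w = c} =
     ennreal ((1/2) ^ Suc (fst c)) * ennreal (layer_mass \<nu> F UNIV (snd c))"
  using emeasure_first_cell[of UNIV c] by simp

lemma nn_integral_first_cell:
  assumes [measurable]: "\<And>c. H c \<in> borel_measurable (sample_space \<nu>)"
  shows "(\<integral>\<^sup>+w. H (first_cell \<nu> F w) w \<partial>sample_space \<nu>) =
    (\<integral>\<^sup>+c. (\<integral>\<^sup>+w. H c w * indicator {w. first_cell \<nu> F w = c} w \<partial>sample_space \<nu>) \<partial>count_space UNIV)"
proof -
  have [measurable]: "{w. first_cell \<nu> F w = c} \<in> sets (sample_space \<nu>)" for c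
    using measurable_sets[OF first_cell_law_measurable, of "{c}"] by (simp add: vimage_def)
  have "H (first_cell \<nu> F w) w = (\<integral>\<^sup>+c. H c w * indicator {w. first_cell \<nu> F w = c} w \<partial>count_space UNIV)" for w
  proof -
    have "(\<integral>\<^sup>+c. H c w * indicator {w. first_cell \<nu> F w = c} w \<partial>count_space UNIV) =
       (\<integral>\<^sup>+c. H (first_cell \<nu> F w) w * indicator {first_cell \<nu> F w} c \<partial>count_space UNIV)"
      by (intro nn_integral_cong) (auto simp: indicator_def)
    then show ?thesis
      by (simp add: nn_integral_cmult)
  qed
  then show ?thesis
    by (simp add: nn_integral_count_space_nn_integral)
qed

text \<open>Correctness of the sampler: summed over all cells, the weights of the rounds give 1 and
  the masses of the layers over \<open>B\<close> give the integral of \<open>F\<close> over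
  \<open>B\<close>.\<close>

lemma distr_point_at_first_cell:
  "distr (sample_space \<nu>) borel (\<lambda>w. point_at w (first_cell \<nu> F w)) = density \<nu> (\<lambda>y. ennreal (F y))"
proof (rule measure_eqI)
  fix B assume "B \<in> sets (distr (sample_space \<nu>) borel (\<lambda>w. point_at w (first_cell \<nu> F w)))"
  then have B [measurable]: "B \<in> sets borel" by simp
  have [measurable]: "(\<lambda>w. point_at w (first_cell \<nu> F w)) \<in> sample_space \<nu> \<rightarrow>\<^sub>M borel"
    by (rule measurable_compose_countable[of "\<lambda>c w. point_at w c"]) measurable
  have [measurable]: "{w. first_cell \<nu> F w = c} \<in> sets (sample_space \<nu>)" for c
    using measurable_sets[OF first_cell_law_measurable, of "{c}"] by (simp add: vimage_def)
  have [measurable]: "{w. point_at w c \<in> B} \<in> sets (sample_space \<nu>)" for c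
    using measurable_sets[OF point_at_measurable B] by (simp add: vimage_def)
  have "{w \<in> space (sample_space \<nu>). point_at w (first_cell \<nu> F w) \<in> B} \<in> sets (sample_space \<nu>)"
    by measurable
  then have "emeasure (distr (sample_space \<nu>) borel (\<lambda>w. point_at w (first_cell \<nu> F w))) B =
    (\<integral>\<^sup>+w. indicator {w. point_at w (first_cell \<nu> F w) \<in> B} w \<partial>sample_space \<nu>)"
    by (simp add: emeasure_distr vimage_def)
  also have "\<dots> = (\<integral>\<^sup>+w. (\<lambda>c. indicator {w. point_at w c \<in> B}) (first_cell \<nu> F w) w \<partial>sample_space \<nu>)"
    by (intro nn_integral_cong) (auto simp: indicator_def)
  also have "\<dots> = (\<integral>\<^sup>+c. emeasure (sample_space \<nu>) {w. first_cell \<nu> F w = c \<and> point_at w c \<in> B} \<partial>count_space UNIV)"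
  proof (subst nn_integral_first_cell)
    show "indicator {w. point_at w c \<in> B} \<in> borel_measurable (sample_space \<nu>)" for c
      by measurable
    show "(\<integral>\<^sup>+c. (\<integral>\<^sup>+w. indicator {w. point_at w c \<in> B} w * indicator {w. first_cell \<nu> F w = c} w \<partial>sample_space \<nu>) \<partial>count_space UNIV)
        = (\<integral>\<^sup>+c. emeasure (sample_space \<nu>) {w. first_cell \<nu> F w = c \<and> point_at w c \<in> B} \<partial>count_space UNIV)"
    proof (intro nn_integral_cong)
      fix c
      have "{w. first_cell \<nu> F w = c} \<inter> {w. point_at w c \<in> B} \<in> sets (sample_space \<nu>)"
        by measurable
      then show "(\<integral>\<^sup>+w. indicator {w. point_at w c \<in> B} w * indicator {w. first_cell \<nu> F w = c} w \<partial>sample_space \<nu>)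
        = emeasure (sample_space \<nu>) {w. first_cell \<nu> F w = c \<and> point_at w c \<in> B}"
        by (simp add: Collect_conj_eq indicator_inter_arith[symmetric] Int_commute)
    qed
  qed
  also have "\<dots> = (\<integral>\<^sup>+c. ennreal ((1/2) ^ Suc (fst c)) * ennreal (layer_mass \<nu> F B (snd c)) \<partial>count_space UNIV)"
    unfolding emeasure_first_cell[OF B] ..
  also have "\<dots> = emeasure (density \<nu> (\<lambda>y. ennreal (F y))) B"
    unfolding nn_integral_count_space_nat_product[of "\<lambda>n. ennreal ((1/2) ^ Suc n)" "\<lambda>k. ennreal (layer_mass \<nu> F B k)"]
      suminf_layer_mass[OF B] suminf_half_powers by (simp add: emeasure_density)
  finally show "emeasure (distr (sample_space \<nu>) borel (\<lambda>w. point_at w (first_cell \<nu> F w))) B =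
    emeasure (density \<nu> (\<lambda>y. ennreal (F y))) B" .
qed (simp add: sets_\<nu>)

text \<open>The average of \<open>sum_layer_ln_le\<close> over \<nu>, in bits. There
  \<open>c\<close> is the constant \<open>1/4\<close> in bits; since \<open>F\<close> has integral
  1, the term \<open>t * (1 + c)\<close> contributes \<open>1 + c\<close>, and cancelling
  \<open>c\<close> leaves the single extra bit.\<close>

lemma suminf_layer_mass_log_le:
  "(\<Sum>k. ennreal (layer_mass \<nu> F UNIV k) * ennreal (log 2 (real k + 3/2))) \<le>
     (\<integral>\<^sup>+y. ennreal (kl_fun (F y) / ln 2) \<partial>\<nu>) + 1"
proof -
  define c :: real where "c = 1 / (4 * ln 2)"
  define S where "S t = (\<Sum>k. ennreal (layer t k) * ennreal (log 2 (real k + 3/2)))" for t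
  have [measurable]: "S \<in> borel_measurable borel"
    unfolding S_def[abs_def] by measurable
  have c: "0 \<le> c" by (simp add: c_def)
  have S: "S t + ennreal c \<le> ennreal (kl_fun t / ln 2) + ennreal t * ennreal (1 + c)" if t: "0 \<le> t" for t
  proof -
    have le: "(\<Sum>k<n. layer t k * log 2 (real k + 3/2)) \<le> kl_fun t / ln 2 + t * (1 + c) - c" for n
    proof -
      have "(\<Sum>k<n. layer t k * log 2 (real k + 3/2)) + c =
          ((\<Sum>k<n. layer t k * ln (real k + 3/2)) + 1/4) / ln 2"
        by (simp add: log_def sum_divide_distrib add_divide_distrib c_def)
      also have "\<dots> \<le> (kl_fun t + t * (ln 2 + 1/4)) / ln 2"
        using sum_layer_ln_le[OF t] by (intro divide_right_mono) auto
      also have "\<dots> = kl_fun t / ln 2 + t * (1 + c)"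
        by (simp add: field_simps c_def)
      finally show ?thesis by simp
    qed
    have "S t \<le> ennreal (kl_fun t / ln 2 + t * (1 + c) - c)"
      unfolding S_def
    proof (rule suminf_le_const)
      fix n
      have "(\<Sum>k<n. ennreal (layer t k) * ennreal (log 2 (real k + 3/2))) = (\<Sum>k<n. ennreal (layer t k * log 2 (real k + 3/2)))"
        by (intro sum.cong refl) (simp add: ennreal_mult)
      also have "\<dots> = ennreal (\<Sum>k<n. layer t k * log 2 (real k + 3/2))"
        by (intro sum_ennreal) simp
      finally show "(\<Sum>k<n. ennreal (layer t k) * ennreal (log 2 (real k + 3/2))) \<le> ennreal (kl_fun t / ln 2 + t * (1 + c) - c)"
        using le[of n] by (simp only: ennreal_leI)
    qed simp
    then have "S t + ennreal c \<le> ennreal (kl_fun t / ln 2 + t * (1 + c) - c) + ennreal c"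
      by (rule add_right_mono)
    \<comment> \<open>The case \<open>n = 0\<close> of \<open>le\<close> shows that the subtracted
      expression is nonnegative, so \<open>ennreal\<close> has not truncated it.\<close>
    also have "\<dots> = ennreal (kl_fun t / ln 2 + t * (1 + c))"
      using le[of 0] c by (subst ennreal_plus[symmetric]) auto
    also have "\<dots> = ennreal (kl_fun t / ln 2) + ennreal t * ennreal (1 + c)"
      using t c kl_fun_nonneg[OF t] by (simp only: ennreal_plus ennreal_mult mult_nonneg_nonneg divide_nonneg_nonneg
          ln_ge_zero add_nonneg_nonneg zero_le_one zero_le_numeral one_le_numeral)
    finally show ?thesis .
  qed
  have "(\<Sum>k. ennreal (layer_mass \<nu> F UNIV k) * ennreal (log 2 (real k + 3/2))) =
      (\<Sum>k. \<integral>\<^sup>+y. ennreal (layer (F y) k) * ennreal (log 2 (real k + 3/2)) \<partial>\<nu>)"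
    by (intro suminf_cong) (simp add: ennreal_layer_mass nn_integral_multc)
  also have "\<dots> = (\<integral>\<^sup>+y. S (F y) \<partial>\<nu>)"
    unfolding S_def by (rule nn_integral_suminf[symmetric]) measurable
  finally have "(\<Sum>k. ennreal (layer_mass \<nu> F UNIV k) * ennreal (log 2 (real k + 3/2))) + ennreal c =
      (\<integral>\<^sup>+y. S (F y) + ennreal c \<partial>\<nu>)"
    using \<nu>.emeasure_space_1 by (simp add: nn_integral_add)
  also have "\<dots> \<le> (\<integral>\<^sup>+y. ennreal (kl_fun (F y) / ln 2) + ennreal (F y) * ennreal (1 + c) \<partial>\<nu>)"
    by (intro nn_integral_mono S F_nonneg)
  also have "\<dots> = (\<integral>\<^sup>+y. ennreal (kl_fun (F y) / ln 2) \<partial>\<nu>) + ennreal (1 + c)"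
    using F_density by (simp add: nn_integral_add nn_integral_multc del: ennreal_plus)
  also have "\<dots> = (\<integral>\<^sup>+y. ennreal (kl_fun (F y) / ln 2) \<partial>\<nu>) + 1 + ennreal c"
    using c by (simp add: add.assoc)
  finally show ?thesis
    unfolding add.commute[of _ "ennreal c"] ennreal_add_left_cancel_le by simp
qed

end

section \<open>Divergence from the reference output law\<close>

lemma KL_div_density:
  fixes g :: "'a \<Rightarrow> real"
  assumes "sigma_finite_measure N" and [measurable]: "g \<in> borel_measurable N" and "\<And>x. 0 \<le> g x"
  shows "KL_div (density N (\<lambda>x. ennreal (g x))) N = (\<integral>\<^sup>+x. ennreal (kl_fun (g x) / ln 2) \<partial>N)"
proof -
  interpret N: sigma_finite_measure N by fact
  have "AE x in N. ennreal (g x) = RN_deriv N (density N (\<lambda>x. ennreal (g x))) x"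
    by (rule N.RN_deriv_unique) auto
  then have "KL_div (density N (\<lambda>x. ennreal (g x))) N =
      (\<integral>\<^sup>+x. ennreal (let f = g x in (f * ln f - f + 1) / ln 2) \<partial>N)"
    unfolding KL_div_def using assms(3)
    by (auto simp: absolutely_continuousI_density intro!: nn_integral_cong_AE elim!: eventually_mono)
      (metis enn2real_ennreal)
  then show ?thesis
    by (simp add: kl_fun_def Let_def)
qed

lemma ex_real_density:
  assumes "prob_space M" "prob_space N" "absolutely_continuous N M" "sets M = sets N"
  obtains g :: "'a \<Rightarrow> real" where "g \<in> borel_measurable N" "\<And>x. 0 \<le> g x" "M = density N (\<lambda>x. ennreal (g x))"
proof -
  interpret M: prob_space M by fact
  interpret N: prob_space N by fact
  define g where "g x = enn2real (RN_deriv N M x)" for x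
  have [measurable]: "g \<in> borel_measurable N"
    unfolding g_def[abs_def] by measurable
  have "AE x in N. RN_deriv N M x \<noteq> \<infinity>"
    using assms M.sigma_finite_measure_axioms by (intro N.RN_deriv_finite) auto
  then have "AE x in N. RN_deriv N M x = ennreal (g x)"
    by (auto elim!: eventually_mono simp: g_def less_top)
  then have "density N (RN_deriv N M) = density N (\<lambda>x. ennreal (g x))"
    by (intro density_cong) (auto simp: g_def)
  then have "M = density N (\<lambda>x. ennreal (g x))"
    using N.density_RN_deriv[OF assms(3,4)] by simp
  then show ?thesis
    by (intro that[of g]) (auto simp: g_def)
qed

lemma KL_div_finite_imp_absolutely_continuous: "KL_div M N < \<infinity> \<Longrightarrow> absolutely_continuous N M"
  by (auto simp: KL_div_def split: if_splits)

lemma KL_div_self: "prob_space M \<Longrightarrow> KL_div M M = 0"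
  using KL_div_density[of M "\<lambda>_. 1"]
  by (simp add: prob_space_imp_sigma_finite density_1 kl_fun_def)

section \<open>Joint and output laws of a kernel\<close>

locale channel =
  fixes Q :: "'a::topological_space \<Rightarrow> 'b::topological_space measure"
  assumes Q_kernel [measurable]: "Q \<in> borel \<rightarrow>\<^sub>M prob_algebra borel"
begin

lemma Q_subprob [measurable]: "Q \<in> borel \<rightarrow>\<^sub>M subprob_algebra borel"
  using Q_kernel by (rule measurable_prob_algebraD)

lemma prob_space_Q: "prob_space (Q x)" and sets_Q [measurable_cong]: "sets (Q x) = sets borel"
  using measurable_space[OF Q_kernel, of x] by (auto simp: space_prob_algebra)

lemma nn_integral_Q_measurable:
  assumes "F \<in> borel_measurable (borel \<Otimes>\<^sub>M borel)"
  shows "(\<lambda>x. \<integral>\<^sup>+y. F (x, y) \<partial>Q x) \<in> borel_measurable borel"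
  using assms by (intro nn_integral_measurable_subprob_algebra2[OF _ Q_subprob]) simp

lemma joint_kernel: "(\<lambda>x. distr (Q x) (borel \<Otimes>\<^sub>M borel) (Pair x)) \<in> borel \<rightarrow>\<^sub>M prob_algebra (borel \<Otimes>\<^sub>M borel)"
  by (rule measurable_distr_prob_space2[OF Q_kernel]) simp

context
  fixes \<mu> :: "'a measure"
  assumes \<mu>: "prob_space \<mu>" and sets_\<mu> [measurable_cong]: "sets \<mu> = sets borel"
begin

lemma kernel_on: "N \<in> borel \<rightarrow>\<^sub>M L \<Longrightarrow> N \<in> \<mu> \<rightarrow>\<^sub>M L"
  by (simp cong: measurable_cong_sets add: sets_\<mu>)

lemma \<mu>_in_prob_algebra: "\<mu> \<in> space (prob_algebra borel)"
  using \<mu> sets_\<mu> by (simp add: space_prob_algebra)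

lemma sets_joint_law: "sets (joint_law \<mu> Q) = sets (borel \<Otimes>\<^sub>M borel)"
  and prob_space_joint_law: "prob_space (joint_law \<mu> Q)"
  and sets_output: "sets (\<mu> \<bind> Q) = sets borel"
  and prob_space_output: "prob_space (\<mu> \<bind> Q)"
  unfolding joint_law_def
  using sets_bind'[OF \<mu>_in_prob_algebra joint_kernel] prob_space_bind'[OF \<mu>_in_prob_algebra joint_kernel]
    sets_bind'[OF \<mu>_in_prob_algebra Q_kernel] prob_space_bind'[OF \<mu>_in_prob_algebra Q_kernel]
  by auto

lemma nn_integral_joint_law:
  assumes [measurable]: "F \<in> borel_measurable (borel \<Otimes>\<^sub>M borel)"
  shows "(\<integral>\<^sup>+p. F p \<partial>joint_law \<mu> Q) = (\<integral>\<^sup>+x. (\<integral>\<^sup>+y. F (x, y) \<partial>Q x) \<partial>\<mu>)"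
  unfolding joint_law_def
  by (subst nn_integral_bind[OF assms kernel_on[OF measurable_prob_algebraD[OF joint_kernel]]])
     (simp add: nn_integral_distr)

lemma nn_integral_output:
  "F \<in> borel_measurable borel \<Longrightarrow> (\<integral>\<^sup>+y. F y \<partial>(\<mu> \<bind> Q)) = (\<integral>\<^sup>+x. (\<integral>\<^sup>+y. F y \<partial>Q x) \<partial>\<mu>)"
  by (rule nn_integral_bind[OF _ kernel_on[OF Q_subprob]])

lemma nn_integral_joint_law_fst:
  assumes [measurable]: "F \<in> borel_measurable borel"
  shows "(\<integral>\<^sup>+p. F (fst p) \<partial>joint_law \<mu> Q) = (\<integral>\<^sup>+x. F x \<partial>\<mu>)"
  using prob_space.emeasure_space_1[OF prob_space_Q]
  by (subst nn_integral_joint_law) auto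

lemma nn_integral_joint_law_snd:
  assumes [measurable]: "F \<in> borel_measurable borel"
  shows "(\<integral>\<^sup>+p. F (snd p) \<partial>joint_law \<mu> Q) = (\<integral>\<^sup>+y. F y \<partial>(\<mu> \<bind> Q))"
  by (subst nn_integral_joint_law) (auto simp: nn_integral_output)

end

end

text \<open>Taking a density of the joint law, rather than one for each \<open>Q x\<close>, makes
  \<open>f\<close> jointly measurable. The price is that \<open>f (x, y)\<close> is a probability
  density in \<open>y\<close> only for almost every \<open>x\<close>.\<close>

locale channel_density = channel Q for Q :: "'a::topological_space \<Rightarrow> 'b::topological_space measure" +
  fixes \<mu>0 :: "'a measure" and f :: "'a \<times> 'b \<Rightarrow> real"
  assumes \<mu>0: "prob_space \<mu>0" and sets_\<mu>0 [measurable_cong]: "sets \<mu>0 = sets borel"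
    and f_meas [measurable]: "f \<in> borel_measurable (borel \<Otimes>\<^sub>M borel)"
    and f_nonneg: "0 \<le> f p"
    and joint_\<mu>0: "joint_law \<mu>0 Q = density (\<mu>0 \<Otimes>\<^sub>M (\<mu>0 \<bind> Q)) (\<lambda>p. ennreal (f p))"
begin

abbreviation "\<nu> \<equiv> \<mu>0 \<bind> Q"

lemma sets_output0 [measurable_cong]: "sets \<nu> = sets borel"
  using sets_output[OF \<mu>0 sets_\<mu>0] .

sublocale M: prob_space \<mu>0 by (rule \<mu>0)
sublocale Y: prob_space \<nu> by (rule prob_space_output[OF \<mu>0 sets_\<mu>0])
sublocale MY: pair_sigma_finite \<mu>0 \<nu> ..

lemma nn_integral_\<nu>_measurable:
  assumes [measurable]: "F \<in> borel_measurable (borel \<Otimes>\<^sub>M borel)"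
  shows "(\<lambda>x. \<integral>\<^sup>+y. F (x, y) \<partial>\<nu>) \<in> borel_measurable borel"
  by measurable

lemma nn_integral_f:
  assumes [measurable]: "F \<in> borel_measurable (borel \<Otimes>\<^sub>M borel)"
  shows "(\<integral>\<^sup>+p. ennreal (f p) * F p \<partial>(\<mu>0 \<Otimes>\<^sub>M \<nu>)) = (\<integral>\<^sup>+p. F p \<partial>joint_law \<mu>0 Q)"
  unfolding joint_\<mu>0 by (subst nn_integral_density) auto

text \<open>The first marginal of the joint law is \<mu>0, so the integral over \<open>y\<close> is
  a density of \<mu>0 with respect to itself, and densities are unique almost everywhere.\<close>

lemma AE_f_density: "AE x in \<mu>0. (\<integral>\<^sup>+y. ennreal (f (x, y)) \<partial>\<nu>) = 1"
proof -
  have "density \<mu>0 (\<lambda>x. \<integral>\<^sup>+y. ennreal (f (x, y)) \<partial>\<nu>) = density \<mu>0 (\<lambda>_. 1)"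
  proof (rule measure_eqI)
    fix A assume "A \<in> sets (density \<mu>0 (\<lambda>x. \<integral>\<^sup>+y. ennreal (f (x, y)) \<partial>\<nu>))"
    then have [measurable]: "A \<in> sets borel" by (simp add: sets_\<mu>0)
    have "emeasure (density \<mu>0 (\<lambda>x. \<integral>\<^sup>+y. ennreal (f (x, y)) \<partial>\<nu>)) A =
        (\<integral>\<^sup>+x. (\<integral>\<^sup>+y. ennreal (f (x, y)) * indicator A x \<partial>\<nu>) \<partial>\<mu>0)"
      by (simp add: emeasure_density nn_integral_multc)
    also have "\<dots> = (\<integral>\<^sup>+p. ennreal (f p) * indicator A (fst p) \<partial>(\<mu>0 \<Otimes>\<^sub>M \<nu>))"
      by (subst Y.nn_integral_fst[symmetric]) auto
    also have "\<dots> = emeasure \<mu>0 A"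
      by (simp add: nn_integral_f nn_integral_joint_law_fst[OF \<mu>0 sets_\<mu>0])
    finally show "emeasure (density \<mu>0 (\<lambda>x. \<integral>\<^sup>+y. ennreal (f (x, y)) \<partial>\<nu>)) A = emeasure (density \<mu>0 (\<lambda>_. 1)) A"
      by (simp add: density_1)
  qed simp
  then show ?thesis
    by (subst (asm) M.density_unique_iff) auto
qed

context
  fixes \<mu> :: "'a measure" and h :: "'a \<Rightarrow> real"
  assumes \<mu>: "prob_space \<mu>" and h_meas [measurable]: "h \<in> borel_measurable borel"
    and h_nonneg: "\<And>x. 0 \<le> h x"
    and \<mu>_density: "\<mu> = density \<mu>0 (\<lambda>x. ennreal (h x))"
begin

lemma sets_\<mu>' [measurable_cong]: "sets \<mu> = sets borel"
  by (simp add: \<mu>_density sets_\<mu>0)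

text \<open>Changing the input law leaves the kernel untouched, so it only reweights the joint law
  by a function of the first coordinate.\<close>

lemma joint_law_density:
  "joint_law \<mu> Q = density (\<mu>0 \<Otimes>\<^sub>M \<nu>) (\<lambda>p. ennreal (h (fst p) * f p))"
proof (rule measure_eqI)
  fix A assume "A \<in> sets (joint_law \<mu> Q)"
  then have [measurable]: "A \<in> sets (borel \<Otimes>\<^sub>M borel)"
    by (simp add: sets_joint_law[OF \<mu> sets_\<mu>'])
  then have A [measurable]: "A \<in> sets (\<mu>0 \<Otimes>\<^sub>M \<nu>)"
    by measurable
  have "emeasure (joint_law \<mu> Q) A = (\<integral>\<^sup>+p. indicator A p \<partial>joint_law \<mu> Q)"
    by (simp add: sets_joint_law[OF \<mu> sets_\<mu>'])
  also have "\<dots> = (\<integral>\<^sup>+x. (\<integral>\<^sup>+y. indicator A (x, y) \<partial>Q x) \<partial>\<mu>)"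
    by (rule nn_integral_joint_law[OF \<mu> sets_\<mu>']) measurable
  also have "\<dots> = (\<integral>\<^sup>+x. (\<integral>\<^sup>+y. ennreal (h x) * indicator A (x, y) \<partial>Q x) \<partial>\<mu>0)"
    unfolding \<mu>_density using nn_integral_Q_measurable[of "indicator A"]
    by (subst nn_integral_density)
       (auto simp: nn_integral_cmult cong: measurable_cong_sets simp: sets_\<mu>0)
  also have "\<dots> = (\<integral>\<^sup>+p. ennreal (h (fst p)) * indicator A p \<partial>joint_law \<mu>0 Q)"
    by (subst nn_integral_joint_law[OF \<mu>0 sets_\<mu>0]) auto
  also have "\<dots> = emeasure (density (\<mu>0 \<Otimes>\<^sub>M \<nu>) (\<lambda>p. ennreal (h (fst p) * f p))) A"
    using f_nonneg h_nonneg
    by (subst nn_integral_f[symmetric]) (auto simp: emeasure_density ennreal_mult ac_simps)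
  finally show "emeasure (joint_law \<mu> Q) A = emeasure (density (\<mu>0 \<Otimes>\<^sub>M \<nu>) (\<lambda>p. ennreal (h (fst p) * f p))) A" .
qed (simp add: sets_joint_law[OF \<mu> sets_\<mu>'] sets_\<mu>0 sets_output0 cong: sets_pair_measure_cong)

lemma nn_integral_\<mu>:
  assumes [measurable]: "F \<in> borel_measurable borel"
  shows "(\<integral>\<^sup>+x. F x \<partial>\<mu>) = (\<integral>\<^sup>+x. ennreal (h x) * F x \<partial>\<mu>0)"
  unfolding \<mu>_density by (rule nn_integral_density) auto

text \<open>The last clause ties \<open>r\<close> to the marginal of \<open>h * f\<close>; it is
  what later forces \<open>h * f\<close> to vanish where \<open>r\<close> does.\<close>

lemma ex_output_density:
  obtains r :: "'b \<Rightarrow> real" where "r \<in> borel_measurable borel" "\<And>y. 0 \<le> r y"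
    "\<mu> \<bind> Q = density \<nu> (\<lambda>y. ennreal (r y))"
    "AE y in \<nu>. (\<integral>\<^sup>+x. ennreal (h x * f (x, y)) \<partial>\<mu>0) = ennreal (r y)"
proof -
  define R where "R y = (\<integral>\<^sup>+x. ennreal (h x * f (x, y)) \<partial>\<mu>0)" for y
  have [measurable]: "R \<in> borel_measurable borel"
    unfolding R_def by measurable
  have R: "(\<integral>\<^sup>+y. R y * F y \<partial>\<nu>) = (\<integral>\<^sup>+y. F y \<partial>(\<mu> \<bind> Q))"
    if [measurable]: "F \<in> borel_measurable borel" for F
  proof -
    have "(\<integral>\<^sup>+y. R y * F y \<partial>\<nu>) = (\<integral>\<^sup>+y. (\<integral>\<^sup>+x. ennreal (h x * f (x, y)) * F y \<partial>\<mu>0) \<partial>\<nu>)"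
      by (simp add: R_def nn_integral_multc)
    also have "\<dots> = (\<integral>\<^sup>+p. ennreal (h (fst p) * f p) * F (snd p) \<partial>(\<mu>0 \<Otimes>\<^sub>M \<nu>))"
      using MY.nn_integral_snd[of "\<lambda>p. ennreal (h (fst p) * f p) * F (snd p)"] by simp
    also have "\<dots> = (\<integral>\<^sup>+p. F (snd p) \<partial>joint_law \<mu> Q)"
      unfolding joint_law_density by (subst nn_integral_density) auto
    also have "\<dots> = (\<integral>\<^sup>+y. F y \<partial>(\<mu> \<bind> Q))"
      by (rule nn_integral_joint_law_snd[OF \<mu> sets_\<mu>']) measurable
    finally show ?thesis .
  qed
  have dens: "\<mu> \<bind> Q = density \<nu> R"
  proof (rule measure_eqI)
    fix B assume "B \<in> sets (\<mu> \<bind> Q)"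
    then have [measurable]: "B \<in> sets borel" by (simp add: sets_output[OF \<mu> sets_\<mu>'])
    then have "B \<in> sets (\<mu> \<bind> Q)" "B \<in> sets \<nu>" by (simp_all add: sets_output[OF \<mu> sets_\<mu>'] sets_output0)
    then show "emeasure (\<mu> \<bind> Q) B = emeasure (density \<nu> R) B"
      using R[of "indicator B"] by (simp add: emeasure_density)
  qed (simp add: sets_output[OF \<mu> sets_\<mu>'] sets_output0)
  have "(\<integral>\<^sup>+y. R y \<partial>\<nu>) = 1"
    using R[of "\<lambda>_. 1"] prob_space.emeasure_space_1[OF prob_space_output[OF \<mu> sets_\<mu>']] by simp
  then have "AE y in \<nu>. R y \<noteq> \<infinity>"
    by (intro nn_integral_noteq_infinite) auto
  then have AE: "AE y in \<nu>. R y = ennreal (enn2real (R y))"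
    by (auto elim!: eventually_mono simp: less_top)
  have "\<mu> \<bind> Q = density \<nu> (\<lambda>y. ennreal (enn2real (R y)))"
    unfolding dens using AE by (intro density_cong) auto
  with AE show ?thesis
    by (intro that[of "\<lambda>y. enn2real (R y)"]) (auto simp: R_def)
qed

text \<open>Writing \<open>r\<close> for the density of the output law of \<open>\<mu>\<close>, the excess of the left-hand side over
  \<open>mutual_info \<mu> Q\<close> is the divergence of the output laws, which is at most \<open>KL_div \<mu> \<mu>0\<close> by data
  processing. Both are contained in the pointwise inequality \<open>kl_fun_chain\<close>, whose summands are
  nonnegative, so that no integrability question arises.\<close>
lemma nn_integral_kl_fun_le:
  "(\<integral>\<^sup>+x. (\<integral>\<^sup>+y. ennreal (kl_fun (f (x, y)) / ln 2) \<partial>\<nu>) \<partial>\<mu>) \<le> mutual_info \<mu> Q + KL_div \<mu> \<mu>0"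
proof -
  obtain r where r [measurable]: "r \<in> borel_measurable borel" and r_nonneg: "\<And>y. 0 \<le> r y"
    and out: "\<mu> \<bind> Q = density \<nu> (\<lambda>y. ennreal (r y))"
    and r_eq: "AE y in \<nu>. (\<integral>\<^sup>+x. ennreal (h x * f (x, y)) \<partial>\<mu>0) = ennreal (r y)"
    using ex_output_density by blast
  let ?N = "\<mu>0 \<Otimes>\<^sub>M \<nu>"
  have prod: "\<mu> \<Otimes>\<^sub>M (\<mu> \<bind> Q) = density ?N (\<lambda>p. ennreal (h (fst p) * r (snd p)))"
  proof -
    have "sigma_finite_measure (density \<nu> (\<lambda>y. ennreal (r y)))"
      using prob_space_output[OF \<mu> sets_\<mu>'] unfolding out by (rule prob_space_imp_sigma_finite)
    then show ?thesis
      unfolding out unfolding \<mu>_density using h_nonneg r_nonneg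
      by (subst pair_measure_density) (auto simp: Y.sigma_finite_measure_axioms ennreal_mult split_beta')
  qed
  \<comment> \<open>For almost every \<open>y\<close> with \<open>r y = 0\<close>, the nonnegative
    function \<open>h x * f (x, y)\<close> of \<open>x\<close> has integral 0. This is the side
    condition of \<open>kl_fun_chain\<close>.\<close>
  have null: "AE p in ?N. r (snd p) = 0 \<longrightarrow> h (fst p) * f p = 0"
  proof -
    have "(\<integral>\<^sup>+p. ennreal (h (fst p) * f p) * indicator {0} (r (snd p)) \<partial>?N) =
        (\<integral>\<^sup>+y. (\<integral>\<^sup>+x. ennreal (h x * f (x, y)) \<partial>\<mu>0) * indicator {0} (r y) \<partial>\<nu>)"
      by (subst MY.nn_integral_snd[symmetric]) (auto simp: nn_integral_multc)
    also have "\<dots> = (\<integral>\<^sup>+y. 0 \<partial>\<nu>)"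
      using r_eq by (intro nn_integral_cong_AE) (auto elim!: eventually_mono simp: indicator_def)
    finally have "AE p in ?N. ennreal (h (fst p) * f p) * indicator {0} (r (snd p)) = 0"
      by (intro nn_integral_0_iff_AE[THEN iffD1]) auto
    then show ?thesis
    proof eventually_elim
      case (elim p)
      then show ?case
        using mult_nonneg_nonneg[OF h_nonneg[of "fst p"] f_nonneg[of p]]
        by (auto simp: ennreal_eq_0_iff)
    qed
  qed
  \<comment> \<open>Relative to the product of its own marginals the factor \<open>h\<close>
    cancels; where \<open>r\<close> is 0 the quotient is 0 by convention, which \<open>null\<close>
    makes correct.\<close>
  have "joint_law \<mu> Q = density (\<mu> \<Otimes>\<^sub>M (\<mu> \<bind> Q)) (\<lambda>p. ennreal (f p / r (snd p)))"
    unfolding prod joint_law_density using null h_nonneg r_nonneg f_nonneg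
    by (subst density_density_eq)
      (auto intro!: density_cong elim!: eventually_mono simp: ennreal_mult[symmetric])
  moreover have "prob_space (\<mu> \<Otimes>\<^sub>M (\<mu> \<bind> Q))"
    by (intro prob_space_pair \<mu> prob_space_output sets_\<mu>')
  ultimately have "mutual_info \<mu> Q = (\<integral>\<^sup>+p. ennreal (kl_fun (f p / r (snd p)) / ln 2) \<partial>(\<mu> \<Otimes>\<^sub>M (\<mu> \<bind> Q)))"
    unfolding mutual_info_def using f_nonneg r_nonneg
    by (simp add: KL_div_density[OF prob_space_imp_sigma_finite] prod)
  also have "\<dots> = (\<integral>\<^sup>+p. ennreal (h (fst p) * r (snd p) * (kl_fun (f p / r (snd p)) / ln 2)) \<partial>?N)"
    unfolding prod using h_nonneg r_nonneg f_nonneg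
    by (subst nn_integral_density) (auto simp: ennreal_mult[symmetric] kl_fun_nonneg)
  finally have I: "mutual_info \<mu> Q = \<dots>" .
  have "KL_div \<mu> \<mu>0 = (\<integral>\<^sup>+x. ennreal (kl_fun (h x) / ln 2) \<partial>\<mu>0)"
    unfolding \<mu>_density using h_nonneg by (intro KL_div_density) (auto simp: M.sigma_finite_measure_axioms)
  also have "\<dots> = (\<integral>\<^sup>+p. ennreal (kl_fun (h (fst p)) / ln 2) \<partial>joint_law \<mu>0 Q)"
    by (rule nn_integral_joint_law_fst[OF \<mu>0 sets_\<mu>0, symmetric]) measurable
  also have "\<dots> = (\<integral>\<^sup>+p. ennreal (f p * (kl_fun (h (fst p)) / ln 2)) \<partial>?N)"
    using h_nonneg f_nonneg
    by (subst nn_integral_f[symmetric]) (auto simp: ennreal_mult[symmetric] kl_fun_nonneg)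
  finally have D: "KL_div \<mu> \<mu>0 = \<dots>" .
  have one_h: "(\<integral>\<^sup>+x. ennreal (h x) \<partial>\<mu>0) = 1"
    using nn_integral_\<mu>[of "\<lambda>_. 1"] prob_space.emeasure_space_1[OF \<mu>] by simp
  have one_r: "(\<integral>\<^sup>+y. ennreal (r y) \<partial>\<nu>) = 1"
    using prob_space.emeasure_space_1[OF prob_space_output[OF \<mu> sets_\<mu>']] unfolding out
    by (simp add: emeasure_density)
  have hN: "(\<integral>\<^sup>+p. ennreal (h (fst p)) \<partial>?N) = 1"
    using one_h Y.emeasure_space_1 by (subst Y.nn_integral_fst[symmetric]) auto
  have hrN: "(\<integral>\<^sup>+p. ennreal (h (fst p) * r (snd p)) \<partial>?N) = 1"
    using prob_space.emeasure_space_1[OF \<open>prob_space (\<mu> \<Otimes>\<^sub>M (\<mu> \<bind> Q))\<close>]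
    unfolding prod by (simp add: emeasure_density)
  have fN: "(\<integral>\<^sup>+p. ennreal (f p) \<partial>?N) = 1"
    using nn_integral_f[of "\<lambda>_. 1"] prob_space.emeasure_space_1[OF prob_space_joint_law[OF \<mu>0 sets_\<mu>0]] by simp
  have rfN: "(\<integral>\<^sup>+p. ennreal (r (snd p) * f p) \<partial>?N) = 1"
    using nn_integral_f[of "\<lambda>p. ennreal (r (snd p))"] one_r f_nonneg r_nonneg
      nn_integral_joint_law_snd[OF \<mu>0 sets_\<mu>0, of "\<lambda>y. ennreal (r y)"]
    by (simp add: ennreal_mult mult.commute)
  \<comment> \<open>The functions \<open>f\<close>, \<open>h * r\<close>, \<open>h\<close> and
    \<open>r * f\<close> all have integral 1, so the linear terms of \<open>kl_fun_chain\<close>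
    contribute the same finite amount \<open>2 / ln 2\<close> to both sides.\<close>
  have "(\<integral>\<^sup>+p. ennreal (h (fst p) * (kl_fun (f p) / ln 2)) \<partial>?N) + 2 * ennreal (1 / ln 2) =
      (\<integral>\<^sup>+p. ennreal (h (fst p) * (kl_fun (f p) / ln 2)) + (ennreal (f p) + ennreal (h (fst p) * r (snd p))) * ennreal (1 / ln 2) \<partial>?N)"
    by (simp add: nn_integral_add nn_integral_multc fN hrN)
  also have "\<dots> \<le> (\<integral>\<^sup>+p. ennreal (h (fst p) * r (snd p) * (kl_fun (f p / r (snd p)) / ln 2)) + ennreal (f p * (kl_fun (h (fst p)) / ln 2)) + (ennreal (h (fst p)) + ennreal (r (snd p) * f p)) * ennreal (1 / ln 2) \<partial>?N)"
  proof (intro nn_integral_mono_AE)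
    show "AE p in ?N. ennreal (h (fst p) * (kl_fun (f p) / ln 2)) + (ennreal (f p) + ennreal (h (fst p) * r (snd p))) * ennreal (1 / ln 2)
      \<le> ennreal (h (fst p) * r (snd p) * (kl_fun (f p / r (snd p)) / ln 2)) + ennreal (f p * (kl_fun (h (fst p)) / ln 2)) + (ennreal (h (fst p)) + ennreal (r (snd p) * f p)) * ennreal (1 / ln 2)"
      using null
    proof eventually_elim
      case (elim p)
      have nn: "0 \<le> h (fst p)" "0 \<le> f p" "0 \<le> r (snd p)"
        using h_nonneg f_nonneg r_nonneg by auto
      have "(h (fst p) * kl_fun (f p) + (f p + h (fst p) * r (snd p))) / ln 2 \<le>
        (h (fst p) * r (snd p) * kl_fun (f p / r (snd p)) + f p * kl_fun (h (fst p)) + (h (fst p) + r (snd p) * f p)) / ln 2"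
        using kl_fun_chain[OF nn] elim by (intro divide_right_mono) auto
      then show ?case
        using nn kl_fun_nonneg[of "h (fst p)"] kl_fun_nonneg[of "f p"] kl_fun_nonneg[of "f p / r (snd p)"]
        by (simp add: ennreal_plus[symmetric] ennreal_mult[symmetric] add_divide_distrib del: ennreal_plus)
    qed
  qed
  also have "\<dots> = mutual_info \<mu> Q + KL_div \<mu> \<mu>0 + 2 * ennreal (1 / ln 2)"
    unfolding I D by (simp add: nn_integral_add nn_integral_multc hN rfN)
  finally have "(\<integral>\<^sup>+p. ennreal (h (fst p) * (kl_fun (f p) / ln 2)) \<partial>?N) \<le> mutual_info \<mu> Q + KL_div \<mu> \<mu>0"
    by (simp add: add.commute[of _ "2 * ennreal (1 / ln 2)"] ennreal_add_left_cancel_le ennreal_mult_eq_top_iff)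
  also have "(\<integral>\<^sup>+p. ennreal (h (fst p) * (kl_fun (f p) / ln 2)) \<partial>?N) =
     (\<integral>\<^sup>+x. (\<integral>\<^sup>+y. ennreal (kl_fun (f (x, y)) / ln 2) \<partial>\<nu>) \<partial>\<mu>)"
    using h_nonneg f_nonneg
    by (simp add: Y.nn_integral_fst[symmetric] nn_integral_\<mu> ennreal_mult kl_fun_nonneg
        nn_integral_cmult del: times_divide_eq_right)
  finally show ?thesis .
qed

end

end

section \<open>Coding the accepted cell\<close>

text \<open>The geometric factor is exactly the law of the round. The power-law factor does not
  depend on the density, so one code serves all inputs.\<close>

definition cell_code :: "real \<Rightarrow> nat \<times> nat \<Rightarrow> real" where
  "cell_code a c = (1/2) ^ Suc (fst c) * (a * (real (snd c) + 3/2) powr (- (1 + a)))"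

lemma cell_code_pos: "0 < a \<Longrightarrow> 0 < cell_code a c"
  by (simp add: cell_code_def)

lemma nn_integral_cell_code_le_1:
  assumes "0 < a"
  shows "(\<integral>\<^sup>+c. ennreal (cell_code a c) \<partial>count_space UNIV) \<le> 1"
proof -
  let ?w = "\<lambda>k::nat. a * (real k + 3/2) powr (- (1 + a))"
  have "(\<integral>\<^sup>+c. ennreal (cell_code a c) \<partial>count_space UNIV) =
      (\<integral>\<^sup>+c. ennreal ((1/2) ^ Suc (fst c)) * ennreal (?w (snd c)) \<partial>count_space UNIV)"
    unfolding cell_code_def using assms by (intro nn_integral_cong ennreal_mult) simp_all
  also have "\<dots> = (\<Sum>k. ennreal (?w k))"
    unfolding nn_integral_count_space_nat_product[of "\<lambda>n. ennreal ((1/2) ^ Suc n)" "\<lambda>k. ennreal (?w k)"]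
      suminf_half_powers by simp
  also have "\<dots> \<le> 1"
  proof (rule suminf_le_const)
    fix n
    have "(\<Sum>k<n. ennreal (?w k)) = ennreal (\<Sum>k<n. ?w k)"
      using assms by (intro sum_ennreal) simp
    also have "\<dots> \<le> ennreal 1"
      by (rule ennreal_leI[OF sum_shifted_powr_le_1[OF assms]])
    finally show "(\<Sum>k<n. ennreal (?w k)) \<le> 1"
      by (simp only: ennreal_1)
  qed simp
  finally show ?thesis .
qed

lemma log_cell_code:
  assumes "0 < a"
  shows "log 2 (1 / cell_code a c) = real (Suc (fst c)) + log 2 (1 / a) + (1 + a) * log 2 (real (snd c) + 3/2)"
proof -
  have "log 2 (1 / cell_code a c) = - log 2 (cell_code a c)"
    using cell_code_pos[OF assms, of c] by (simp add: log_divide)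
  also have "log 2 (cell_code a c) = log 2 ((1/2) ^ Suc (fst c)) + (log 2 a + log 2 ((real (snd c) + 3/2) powr (- (1 + a))))"
    unfolding cell_code_def using assms by (subst log_mult_pos; (subst log_mult_pos)?) simp_all
  also have "log 2 ((1/2 :: real) ^ Suc (fst c)) = - real (Suc (fst c))"
    by (subst log_nat_power) (simp_all add: log_divide)
  also have "log 2 ((real (snd c) + 3/2) powr (- (1 + a))) = - (1 + a) * log 2 (real (snd c) + 3/2)"
    by (subst log_powr) simp_all
  also have "log 2 a = - log 2 (1 / a)"
    using assms by (simp add: log_divide)
  finally show ?thesis
    by (simp add: algebra_simps)
qed

text \<open>The mean number of rounds, from the differentiated geometric series.\<close>

lemma suminf_Suc_half_powers: "(\<Sum>n. ennreal (real (Suc n)) * ennreal ((1/2) ^ Suc n)) = 2"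
proof -
  have "(\<lambda>n. real (Suc n) * (1/2) ^ n * (1/2)) sums (1 / (1 - 1/2)\<^sup>2 * (1/2))"
    using geometric_deriv_sums[of "1/2 :: real"] by (intro sums_mult2) simp
  then have "(\<lambda>n. real (Suc n) * (1/2) ^ Suc n) sums 2"
    by (simp add: power2_eq_square mult_ac)
  then have "(\<Sum>n. ennreal (real (Suc n) * (1/2) ^ Suc n)) = ennreal 2"
    by (intro suminf_ennreal_eq) simp_all
  then show ?thesis
    by (simp add: ennreal_mult del: power_Suc of_nat_Suc)
qed

text \<open>The logarithm splits the code length into a part for the round, a constant and a part
  for the layer. As the law of the cell is a product, these average to the mean number of rounds,
  the constant, and \<open>1 + a\<close> times the bound of
  \<open>suminf_layer_mass_log_le\<close>.\<close>

lemma (in layered_sampler) nn_integral_log_cell_code_le: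
  assumes "0 < a" "a \<le> 1"
  shows "(\<integral>\<^sup>+w. ennreal (log 2 (1 / cell_code a (first_cell \<nu> F w))) \<partial>sample_space \<nu>) \<le>
    2 + ennreal (log 2 (1 / a)) + ennreal (1 + a) * ((\<integral>\<^sup>+y. ennreal (kl_fun (F y) / ln 2) \<partial>\<nu>) + 1)"
proof -
  define p where "p n = ennreal ((1/2) ^ Suc n)" for n :: nat
  define m where "m k = ennreal (layer_mass \<nu> F UNIV k)" for k
  define l where "l k = ennreal (log 2 (real k + 3/2))" for k :: nat
  have log_a: "0 \<le> log 2 (1 / a)"
    using assms by simp
  have code: "ennreal (log 2 (1 / cell_code a c)) * (p (fst c) * m (snd c)) =
      (ennreal (real (Suc (fst c))) * p (fst c)) * m (snd c) + (ennreal (log 2 (1 / a)) * p (fst c)) * m (snd c)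
      + ennreal (1 + a) * (p (fst c) * (m (snd c) * l (snd c)))" for c
  proof -
    have "ennreal (log 2 (1 / cell_code a c)) =
        ennreal (real (Suc (fst c))) + ennreal (log 2 (1 / a)) + ennreal (1 + a) * l (snd c)"
      unfolding log_cell_code[OF assms(1)] l_def using assms log_a
      by (subst ennreal_plus; (subst ennreal_plus)?; (subst ennreal_mult)?) (auto intro!: add_nonneg_nonneg mult_nonneg_nonneg)
    then show ?thesis
      by (simp only: distrib_left distrib_right mult_ac add_ac)
  qed
  have "(\<integral>\<^sup>+w. ennreal (log 2 (1 / cell_code a (first_cell \<nu> F w))) \<partial>sample_space \<nu>) =
      (\<integral>\<^sup>+c. (\<integral>\<^sup>+w. ennreal (log 2 (1 / cell_code a c)) * indicator {w. first_cell \<nu> F w = c} w \<partial>sample_space \<nu>) \<partial>count_space UNIV)"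
    by (rule nn_integral_first_cell[of "\<lambda>c w. ennreal (log 2 (1 / cell_code a c))"]) measurable
  also have "\<dots> = (\<integral>\<^sup>+c. ennreal (log 2 (1 / cell_code a c)) * (p (fst c) * m (snd c)) \<partial>count_space UNIV)"
  proof (intro nn_integral_cong)
    fix c
    have "{w \<in> space (sample_space \<nu>). first_cell \<nu> F w = c} \<in> sets (sample_space \<nu>)"
      by measurable
    then show "(\<integral>\<^sup>+w. ennreal (log 2 (1 / cell_code a c)) * indicator {w. first_cell \<nu> F w = c} w \<partial>sample_space \<nu>)
        = ennreal (log 2 (1 / cell_code a c)) * (p (fst c) * m (snd c))"
      unfolding p_def m_def emeasure_first_cell_eq[symmetric] by (intro nn_integral_cmult_indicator) simp
  qed
  also have "\<dots> = (\<integral>\<^sup>+c. (ennreal (real (Suc (fst c))) * p (fst c)) * m (snd c) \<partial>count_space UNIV)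
      + (\<integral>\<^sup>+c. (ennreal (log 2 (1 / a)) * p (fst c)) * m (snd c) \<partial>count_space UNIV)
      + ennreal (1 + a) * (\<integral>\<^sup>+c. p (fst c) * (m (snd c) * l (snd c)) \<partial>count_space UNIV)"
    unfolding code by (simp only: nn_integral_add nn_integral_cmult borel_measurable_count_space)
  also have "\<dots> = 2 + ennreal (log 2 (1 / a)) + ennreal (1 + a) * (\<Sum>k. m k * l k)"
    unfolding nn_integral_count_space_nat_product[of "\<lambda>n. ennreal (real (Suc n)) * p n" m]
      nn_integral_count_space_nat_product[of "\<lambda>n. ennreal (log 2 (1 / a)) * p n" m]
      nn_integral_count_space_nat_product[of p "\<lambda>k. m k * l k"] ennreal_suminf_cmult
    unfolding p_def m_def suminf_layer_mass_UNIV suminf_half_powers suminf_Suc_half_powers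
    by (simp only: mult_1_left mult_1_right)
  also have "\<dots> \<le> 2 + ennreal (log 2 (1 / a)) + ennreal (1 + a) * ((\<integral>\<^sup>+y. ennreal (kl_fun (F y) / ln 2) \<partial>\<nu>) + 1)"
    unfolding m_def l_def by (intro add_left_mono mult_left_mono suminf_layer_mass_log_le) simp
  finally show ?thesis .
qed

text \<open>The array \<open>w\<close> offers only countably many candidate outputs, so that the image of a code
  for the cells is a code for the output.\<close>
lemma disc_entropy_point_at_le:
  fixes J :: "'a \<Rightarrow> nat \<times> nat" and w :: "nat \<Rightarrow> nat \<Rightarrow> 'b::t1_space \<times> real"
  assumes "prob_space \<mu>" and J: "J \<in> \<mu> \<rightarrow>\<^sub>M count_space UNIV" and a: "0 < a"
  shows "disc_entropy (distr \<mu> borel (\<lambda>x. point_at w (J x))) \<le> (\<integral>\<^sup>+x. ennreal (log 2 (1 / cell_code a (J x))) \<partial>\<mu>)"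
proof -
  interpret prob_space \<mu> by fact
  define q where "q = density (count_space UNIV) (\<lambda>c. ennreal (cell_code a c))"
  define \<kappa> where "\<kappa> = distr q borel (point_at w)"
  have point [measurable]: "point_at w \<in> q \<rightarrow>\<^sub>M borel" "point_at w \<in> count_space UNIV \<rightarrow>\<^sub>M borel"
    by (simp_all add: q_def)
  have J' [measurable]: "(\<lambda>x. point_at w (J x)) \<in> \<mu> \<rightarrow>\<^sub>M borel"
    using J by measurable
  have \<kappa>: "sets \<kappa> = sets borel" "emeasure \<kappa> UNIV \<le> 1"
    using nn_integral_cell_code_le_1[OF a] by (simp_all add: \<kappa>_def emeasure_distr q_def emeasure_density)
  then interpret \<kappa>: subprob_space \<kappa>
    by (intro subprob_spaceI) (simp_all add: \<kappa>_def)
  \<comment> \<open>Several cells may hold the same point, whose weight is then the sum of theirs;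
    merging cells only shortens the code.\<close>
  have code_le: "cell_code a c \<le> measure \<kappa> {point_at w c}" for c
  proof -
    have "ennreal (cell_code a c) = emeasure q {c}"
      unfolding q_def by (subst emeasure_density) (simp_all add: nn_integral_indicator_singleton)
    also have "\<dots> \<le> emeasure \<kappa> {point_at w c}"
      unfolding \<kappa>_def by (subst emeasure_distr) (auto intro!: emeasure_mono simp: q_def)
    finally show ?thesis
      by (simp add: \<kappa>.emeasure_eq_measure)
  qed
  define l where "l y = ennreal (log 2 (1 / measure \<kappa> {y}))" for y
  have null: "measure \<kappa> {y} = 0" if "y \<notin> range (point_at w)" for y
  proof -
    have "point_at w -` {y} = {}"
      using that by auto
    then show ?thesis
      by (simp add: \<kappa>_def measure_distr)
  qed
  \<comment> \<open>Off the countable range the measure is 0, and \<open>1 / 0 = 0\<close> and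
    \<open>log 2 0 = 0\<close> make \<open>l\<close> vanish there. So \<open>l\<close> differs from
    a constant on a countable set only.\<close>
  have [measurable]: "l \<in> borel_measurable borel"
    by (rule measurable_discrete_difference[of "\<lambda>_. 0" borel borel "range (point_at w)"])
       (auto simp: l_def null log_def)
  have "disc_entropy (distr \<mu> borel (\<lambda>x. point_at w (J x))) \<le> (\<integral>\<^sup>+y. l y \<partial>distr \<mu> borel (\<lambda>x. point_at w (J x)))"
    unfolding l_def
  proof (rule disc_entropy_le_cross_entropy[OF _ _ \<kappa>])
    show "prob_space (distr \<mu> borel (\<lambda>x. point_at w (J x)))"
      by (rule prob_space_distr[OF J'])
    have "range (point_at w) \<in> sets borel"
      by (rule sets.countable) (simp_all add: borel_closed)
    then show "AE y in distr \<mu> borel (\<lambda>x. point_at w (J x)). y \<in> range (point_at w)"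
      by (subst AE_distr_iff[OF J']) auto
    show "0 < measure \<kappa> {y}" if "y \<in> range (point_at w)" for y
      using that code_le cell_code_pos[OF a] by (metis less_le_trans rangeE)
  qed auto
  also have "\<dots> = (\<integral>\<^sup>+x. l (point_at w (J x)) \<partial>\<mu>)"
    by (rule nn_integral_distr) measurable
  also have "\<dots> \<le> (\<integral>\<^sup>+x. ennreal (log 2 (1 / cell_code a (J x))) \<partial>\<mu>)"
  proof (intro nn_integral_mono)
    fix x
    have pos: "0 < cell_code a (J x)" "0 < measure \<kappa> {point_at w (J x)}"
      using code_le[of "J x"] cell_code_pos[OF a, of "J x"] by linarith+
    have "1 / measure \<kappa> {point_at w (J x)} \<le> 1 / cell_code a (J x)"
      by (rule divide_left_mono[OF code_le zero_le_one mult_pos_pos[OF pos(2,1)]])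
    then have "log 2 (1 / measure \<kappa> {point_at w (J x)}) \<le> log 2 (1 / cell_code a (J x))"
      using pos by (subst log_le_cancel_iff) simp_all
    then show "l (point_at w (J x)) \<le> ennreal (log 2 (1 / cell_code a (J x)))"
      unfolding l_def by (rule ennreal_leI)
  qed
  finally show ?thesis .
qed

section \<open>Simulating the channel\<close>

locale channel_simulation = channel_density Q \<mu>0 f
  for Q :: "'a::topological_space \<Rightarrow> 'b::t1_space measure" and \<mu>0 f
begin

sublocale L: layer_space \<nu>
  by unfold_locales (rule sets_output0)

abbreviation cell :: "'a \<Rightarrow> (nat \<Rightarrow> nat \<Rightarrow> 'b \<times> real) \<Rightarrow> nat \<times> nat" where
  "cell x \<equiv> first_cell \<nu> (\<lambda>y. f (x, y))"

abbreviation outcome :: "'a \<Rightarrow> (nat \<Rightarrow> nat \<Rightarrow> 'b \<times> real) \<Rightarrow> 'b" where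
  "outcome x w \<equiv> point_at w (cell x w)"

lemma f_curried_measurable: "(\<lambda>(x, y). f (x, y)) \<in> borel_measurable (borel \<Otimes>\<^sub>M borel)"
  by simp

lemma cell_measurable: "(\<lambda>(x, w). cell x w) \<in> borel \<Otimes>\<^sub>M sample_space \<nu> \<rightarrow>\<^sub>M count_space UNIV"
  by (rule L.first_cell_measurable[OF f_curried_measurable])

lemma outcome_measurable: "(\<lambda>(x, w). outcome x w) \<in> borel \<Otimes>\<^sub>M sample_space \<nu> \<rightarrow>\<^sub>M borel"
  by (rule L.point_at_first_cell_measurable[OF f_curried_measurable])

context
  fixes \<mu> :: "'a measure" and h :: "'a \<Rightarrow> real"
  assumes \<mu>: "prob_space \<mu>" and h_meas [measurable]: "h \<in> borel_measurable borel"
    and h_nonneg: "\<And>x. 0 \<le> h x"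
    and \<mu>_density: "\<mu> = density \<mu>0 (\<lambda>x. ennreal (h x))"
begin

text \<open>The exceptional inputs of \<open>AE_f_density\<close> form a \<mu>0-null set, which is
  also null for \<mu> because \<mu> has a density with respect to \<mu>0.\<close>

lemma AE_layered_sampler: "AE x in \<mu>. layered_sampler \<nu> (\<lambda>y. f (x, y))"
proof -
  have "AE x in \<mu>0. layered_sampler \<nu> (\<lambda>y. f (x, y))"
    using AE_f_density
  proof eventually_elim
    case (elim x)
    have "(\<lambda>y. f (x, y)) \<in> borel_measurable borel"
      by measurable
    then show ?case
      by unfold_locales (simp_all add: f_nonneg elim)
  qed
  then show ?thesis
    unfolding \<mu>_density
    by (subst AE_density) (simp add: measurable_cong_sets[OF sets_\<mu>0 refl], elim eventually_mono, simp)
qed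

text \<open>For almost every input the outcome has density \<open>f (x, y)\<close> by
  \<open>distr_point_at_first_cell\<close>; reweighting by \<open>h\<close> gives the density found
  in \<open>joint_law_density\<close>.\<close>

lemma nn_integral_outcome:
  assumes G: "G \<in> borel_measurable (borel \<Otimes>\<^sub>M borel)"
  shows "(\<integral>\<^sup>+x. (\<integral>\<^sup>+w. G (x, outcome x w) \<partial>sample_space \<nu>) \<partial>\<mu>) = (\<integral>\<^sup>+p. G p \<partial>joint_law \<mu> Q)"
proof -
  note [measurable] = G
  have "(\<lambda>p. ennreal (h (fst p) * f p) * G p) \<in> borel_measurable (borel \<Otimes>\<^sub>M borel)"
    by measurable
  then have meas: "(\<lambda>p. ennreal (h (fst p) * f p) * G p) \<in> borel_measurable (\<mu>0 \<Otimes>\<^sub>M \<nu>)"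
    unfolding measurable_cong_sets[OF sets_pair_measure_cong[OF sets_\<mu>0 sets_output0] refl] .
  have sim: "(\<integral>\<^sup>+w. G (x, outcome x w) \<partial>sample_space \<nu>) = (\<integral>\<^sup>+y. ennreal (f (x, y)) * G (x, y) \<partial>\<nu>)"
    if "layered_sampler \<nu> (\<lambda>y. f (x, y))" for x
  proof -
    interpret layered_sampler \<nu> "\<lambda>y. f (x, y)" by fact
    have out: "outcome x \<in> sample_space \<nu> \<rightarrow>\<^sub>M borel"
      using measurable_compose[OF measurable_Pair1' outcome_measurable, of x] by simp
    have Gx: "(\<lambda>y. G (x, y)) \<in> borel_measurable borel" "(\<lambda>y. ennreal (f (x, y))) \<in> borel_measurable borel"
      by measurable
    have "(\<integral>\<^sup>+w. G (x, outcome x w) \<partial>sample_space \<nu>) = (\<integral>\<^sup>+y. G (x, y) \<partial>distr (sample_space \<nu>) borel (outcome x))"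
      using Gx by (intro nn_integral_distr[OF out, symmetric]) simp
    also have "\<dots> = (\<integral>\<^sup>+y. ennreal (f (x, y)) * G (x, y) \<partial>\<nu>)"
      unfolding distr_point_at_first_cell
      by (intro nn_integral_density) (simp_all add: measurable_cong_sets[OF sets_output0 refl] Gx)
    finally show ?thesis .
  qed
  have "(\<integral>\<^sup>+x. (\<integral>\<^sup>+w. G (x, outcome x w) \<partial>sample_space \<nu>) \<partial>\<mu>) =
      (\<integral>\<^sup>+x. (\<integral>\<^sup>+y. ennreal (f (x, y)) * G (x, y) \<partial>\<nu>) \<partial>\<mu>)"
    using AE_layered_sampler by (intro nn_integral_cong_AE) (auto elim!: eventually_mono simp: sim)
  also have "\<dots> = (\<integral>\<^sup>+x. ennreal (h x) * (\<integral>\<^sup>+y. ennreal (f (x, y)) * G (x, y) \<partial>\<nu>) \<partial>\<mu>0)"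
    by (intro nn_integral_\<mu>[OF \<mu> h_meas h_nonneg \<mu>_density]
        nn_integral_\<nu>_measurable[of "\<lambda>p. ennreal (f p) * G p"]) measurable
  also have "\<dots> = (\<integral>\<^sup>+x. (\<integral>\<^sup>+y. ennreal (h x * f (x, y)) * G (x, y) \<partial>\<nu>) \<partial>\<mu>0)"
    using h_nonneg f_nonneg by (simp add: nn_integral_cmult[symmetric] ennreal_mult mult.assoc)
  also have "\<dots> = (\<integral>\<^sup>+p. ennreal (h (fst p) * f p) * G p \<partial>(\<mu>0 \<Otimes>\<^sub>M \<nu>))"
    using meas by (subst Y.nn_integral_fst[symmetric]) (simp_all only: fst_conv)
  also have "\<dots> = (\<integral>\<^sup>+p. G p \<partial>joint_law \<mu> Q)"
    unfolding joint_law_density[OF \<mu> h_meas h_nonneg \<mu>_density]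
    by (rule nn_integral_density[symmetric])
      (simp_all add: G measurable_cong_sets[OF sets_pair_measure_cong[OF sets_\<mu>0 sets_output0] refl])
  finally show ?thesis .
qed

lemma disc_entropy_outcome_le:
  assumes "0 < a"
  shows "disc_entropy (distr \<mu> borel (\<lambda>x. outcome x w)) \<le> (\<integral>\<^sup>+x. ennreal (log 2 (1 / cell_code a (cell x w))) \<partial>\<mu>)"
proof (rule disc_entropy_point_at_le[OF \<mu> _ assms])
  have "(\<lambda>x. cell x w) \<in> borel \<rightarrow>\<^sub>M count_space UNIV"
    using measurable_compose[OF measurable_Pair2' cell_measurable, of w] by simp
  then show "(\<lambda>x. cell x w) \<in> \<mu> \<rightarrow>\<^sub>M count_space UNIV"
    by (simp add: measurable_cong_sets[OF sets_\<mu>'[OF \<mu> h_meas h_nonneg \<mu>_density] refl])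
qed

lemma log_cell_code_measurable:
  "(\<lambda>(x, w). ennreal (log 2 (1 / cell_code a (cell x w)))) \<in> borel_measurable (\<mu> \<Otimes>\<^sub>M sample_space \<nu>)"
proof -
  have "(\<lambda>p. ennreal (log 2 (1 / cell_code a (case_prod cell p)))) \<in> borel_measurable (borel \<Otimes>\<^sub>M sample_space \<nu>)"
    by (rule measurable_compose[OF cell_measurable]) simp
  then show ?thesis
    by (simp add: split_beta' measurable_cong_sets[OF sets_pair_measure_cong[OF sets_\<mu>'[OF \<mu> h_meas h_nonneg \<mu>_density] refl] refl])
qed

text \<open>Entropy is bounded for a fixed array, but the law of the cell is known for a fixed
  input; exchanging the integrals connects the two. The choice \<open>a = 1 / (C + 1)\<close> turns
  the extra cost \<open>a * (C + 1)\<close> of the power law into one bit.\<close>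

lemma nn_integral_log_cell_code_outcome_le:
  assumes C: "0 \<le> C" "mutual_info \<mu> Q + KL_div \<mu> \<mu>0 \<le> ennreal C"
  shows "(\<integral>\<^sup>+w. (\<integral>\<^sup>+x. ennreal (log 2 (1 / cell_code (1 / (C + 1)) (cell x w))) \<partial>\<mu>) \<partial>sample_space \<nu>) \<le>
    ennreal C + ennreal (log 2 (C + 1)) + 4"
proof -
  interpret P: prob_space \<mu> by (rule \<mu>)
  interpret PS: pair_sigma_finite \<mu> "sample_space \<nu>" ..
  define a where "a = 1 / (C + 1)"
  have a: "0 < a" "a \<le> 1" "1 / a = C + 1" "(1 + a) * (C + 1) = C + 2"
    using C(1) by (auto simp: a_def field_simps)
  define d where "d x = (\<integral>\<^sup>+y. ennreal (kl_fun (f (x, y)) / ln 2) \<partial>\<nu>)" for x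
  have d [measurable]: "d \<in> borel_measurable borel"
    unfolding d_def[abs_def] by (intro nn_integral_\<nu>_measurable[of "\<lambda>p. ennreal (kl_fun (f p) / ln 2)"]) measurable
  have d\<mu>: "d \<in> borel_measurable \<mu>"
    using d by (simp add: measurable_cong_sets[OF sets_\<mu>'[OF \<mu> h_meas h_nonneg \<mu>_density] refl])
  have "(\<integral>\<^sup>+w. (\<integral>\<^sup>+x. ennreal (log 2 (1 / cell_code a (cell x w))) \<partial>\<mu>) \<partial>sample_space \<nu>) =
      (\<integral>\<^sup>+x. (\<integral>\<^sup>+w. ennreal (log 2 (1 / cell_code a (cell x w))) \<partial>sample_space \<nu>) \<partial>\<mu>)"
    by (rule PS.Fubini'[OF log_cell_code_measurable])
  also have "\<dots> \<le> (\<integral>\<^sup>+x. 2 + ennreal (log 2 (1 / a)) + ennreal (1 + a) * (d x + 1) \<partial>\<mu>)"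
    using AE_layered_sampler
    by (intro nn_integral_mono_AE)
       (auto elim!: eventually_mono simp only: d_def layered_sampler.nn_integral_log_cell_code_le[OF _ a(1,2)])
  also have "\<dots> = 2 + ennreal (log 2 (1 / a)) + ennreal (1 + a) * ((\<integral>\<^sup>+x. d x \<partial>\<mu>) + 1)"
    using d\<mu> P.emeasure_space_1 by (simp add: nn_integral_add nn_integral_cmult del: ennreal_plus)
  also have "\<dots> \<le> 2 + ennreal (log 2 (1 / a)) + ennreal (1 + a) * (ennreal C + 1)"
    unfolding d_def using order_trans[OF nn_integral_kl_fun_le[OF \<mu> h_meas h_nonneg \<mu>_density] C(2)]
    by (intro add_left_mono mult_left_mono add_right_mono) simp_all
  also have "ennreal (1 + a) * (ennreal C + 1) = ennreal (C + 2)"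
    using a C(1) by (simp add: ennreal_1[symmetric] ennreal_plus[symmetric] ennreal_mult[symmetric] del: ennreal_1 ennreal_plus)
  also have "2 + ennreal (log 2 (1 / a)) + ennreal (C + 2) = ennreal C + ennreal (log 2 (C + 1)) + 4"
    unfolding a(3) using C(1) by (simp add: ennreal_plus ac_simps)
  finally show ?thesis
    unfolding a_def .
qed

end

end

section \<open>Real-valued common randomness and the final bound\<close>

lemma embed_measure_kernel:
  fixes \<phi> :: "'w \<Rightarrow> 'z"
  assumes \<phi>: "inj \<phi>" and T: "(\<lambda>(x, w). T x w) \<in> M \<Otimes>\<^sub>M N \<rightarrow>\<^sub>M L"
  shows "(\<lambda>(x, z). T x (inv \<phi> z)) \<in> M \<Otimes>\<^sub>M embed_measure N \<phi> \<rightarrow>\<^sub>M L"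
proof -
  have "inv \<phi> \<in> embed_measure N \<phi> \<rightarrow>\<^sub>M N"
    using \<phi> by (intro measurable_embed_measure1) simp
  then have "(\<lambda>p. (fst p, inv \<phi> (snd p))) \<in> M \<Otimes>\<^sub>M embed_measure N \<phi> \<rightarrow>\<^sub>M M \<Otimes>\<^sub>M N"
    by measurable
  from measurable_compose[OF this T] show ?thesis
    by (simp add: split_beta')
qed

theorem theorem2:
  fixes \<mu>0 :: "'a::polish_space measure"
    and Q :: "'a \<Rightarrow> 'b::polish_space measure"
    and \<Gamma> :: real
  assumes "sets \<mu>0 = sets borel" and "prob_space \<mu>0"
    and "\<Gamma> \<ge> 0"
    and "Q \<in> borel \<rightarrow>\<^sub>M prob_algebra borel"
    and "\<forall>\<mu>\<in>KL_ball \<mu>0 \<Gamma>. mutual_info \<mu> Q < \<infinity>"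
  shows "\<exists>(PZ :: real measure) (g :: 'a \<Rightarrow> real \<Rightarrow> 'b).
           prob_space PZ \<and>
           (\<lambda>(x, z). g x z) \<in> borel \<Otimes>\<^sub>M PZ \<rightarrow>\<^sub>M borel \<and>
           (\<forall>\<mu>\<in>KL_ball \<mu>0 \<Gamma>.
              distr (\<mu> \<Otimes>\<^sub>M PZ) (borel \<Otimes>\<^sub>M borel) (\<lambda>(x, z). (x, g x z)) = joint_law \<mu> Q \<and>
              cond_entropy_fr \<mu> PZ g
                \<le> sup_mutual_info (KL_ball \<mu>0 \<Gamma>) Q + ennreal \<Gamma>
                   + ennreal (log 2 (enn2real (sup_mutual_info (KL_ball \<mu>0 \<Gamma>) Q + ennreal \<Gamma>) + 1))
                   + 4)"
proof -
  note sets_\<mu>0 = assms(1) and \<mu>0 = assms(2) and Q = assms(4)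
  interpret channel Q by unfold_locales (rule Q)
  \<comment> \<open>The centre of the ball is itself an admissible input law; finiteness of its
    mutual information provides the density \<open>f\<close>.\<close>
  have "\<mu>0 \<in> KL_ball \<mu>0 \<Gamma>"
    by (simp add: KL_ball_def sets_\<mu>0 \<mu>0 KL_div_self)
  then have "mutual_info \<mu>0 Q < \<infinity>"
    using assms(5) by blast
  then have ac: "absolutely_continuous (\<mu>0 \<Otimes>\<^sub>M (\<mu>0 \<bind> Q)) (joint_law \<mu>0 Q)"
    unfolding mutual_info_def by (rule KL_div_finite_imp_absolutely_continuous)
  have sets_prod: "sets (\<mu>0 \<Otimes>\<^sub>M (\<mu>0 \<bind> Q)) = sets (borel \<Otimes>\<^sub>M borel)"
    by (rule sets_pair_measure_cong[OF sets_\<mu>0 sets_output[OF \<mu>0 sets_\<mu>0]])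
  have "prob_space (joint_law \<mu>0 Q)"
    by (rule prob_space_joint_law[OF \<mu>0 sets_\<mu>0])
  moreover have "prob_space (\<mu>0 \<Otimes>\<^sub>M (\<mu>0 \<bind> Q))"
    by (rule prob_space_pair[OF \<mu>0 prob_space_output[OF \<mu>0 sets_\<mu>0]])
  moreover have "sets (joint_law \<mu>0 Q) = sets (\<mu>0 \<Otimes>\<^sub>M (\<mu>0 \<bind> Q))"
    unfolding sets_prod by (rule sets_joint_law[OF \<mu>0 sets_\<mu>0])
  ultimately obtain f where f: "f \<in> borel_measurable (\<mu>0 \<Otimes>\<^sub>M (\<mu>0 \<bind> Q))" "\<And>p. 0 \<le> f p"
      "joint_law \<mu>0 Q = density (\<mu>0 \<Otimes>\<^sub>M (\<mu>0 \<bind> Q)) (\<lambda>p. ennreal (f p))"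
    using ex_real_density[OF _ _ ac] by blast
  have f_meas: "f \<in> borel_measurable (borel \<Otimes>\<^sub>M borel)"
    using f(1) unfolding measurable_cong_sets[OF sets_prod refl] .
  have "channel_density_axioms Q \<mu>0 f"
    by (rule channel_density_axioms.intro[OF \<mu>0 sets_\<mu>0 f_meas f(2,3)])
  then interpret channel_simulation Q \<mu>0 f
    by (rule channel_simulation.intro[OF channel_density.intro[OF channel_axioms]])
  obtain \<phi> :: "(nat \<Rightarrow> nat \<Rightarrow> 'b \<times> real) \<Rightarrow> real" where \<phi>: "inj \<phi>"
    using ex_inj_real by blast
  \<comment> \<open>\<open>PZ\<close> lives on the range of \<open>\<phi>\<close> with the transported sigma-algebra, which is why a mere
    injection (instead of a Borel isomorphism) suffices.\<close>
  define PZ where "PZ = embed_measure (sample_space \<nu>) \<phi>"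
  define g where "g x z = outcome x (inv \<phi> z)" for x z
  have nn_integral_PZ: "(\<integral>\<^sup>+z. F (inv \<phi> z) \<partial>PZ) = (\<integral>\<^sup>+w. F w \<partial>sample_space \<nu>)"
    if "F \<in> borel_measurable (sample_space \<nu>)" for F
    unfolding PZ_def using \<phi> that
    by (subst nn_integral_embed_measure) (simp_all add: measurable_embed_measure1)
  have PZ: "prob_space PZ"
    unfolding PZ_def
    by (subst embed_measure_eq_distr[OF \<phi>])
       (rule L.S'.prob_space_distr[OF measurable_embed_measure2[OF \<phi>]])
  have g: "(\<lambda>(x, z). g x z) \<in> borel \<Otimes>\<^sub>M PZ \<rightarrow>\<^sub>M borel"
    unfolding g_def PZ_def by (rule embed_measure_kernel[OF \<phi> outcome_measurable])
  have "distr (\<mu> \<Otimes>\<^sub>M PZ) (borel \<Otimes>\<^sub>M borel) (\<lambda>(x, z). (x, g x z)) = joint_law \<mu> Q \<and>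
      cond_entropy_fr \<mu> PZ g
        \<le> sup_mutual_info (KL_ball \<mu>0 \<Gamma>) Q + ennreal \<Gamma>
           + ennreal (log 2 (enn2real (sup_mutual_info (KL_ball \<mu>0 \<Gamma>) Q + ennreal \<Gamma>) + 1)) + 4"
    if ball: "\<mu> \<in> KL_ball \<mu>0 \<Gamma>" for \<mu>
  proof
    have \<mu>: "prob_space \<mu>" and sets_\<mu>: "sets \<mu> = sets borel" and KL: "KL_div \<mu> \<mu>0 \<le> ennreal \<Gamma>"
      using ball by (auto simp: KL_ball_def)
    interpret P: prob_space \<mu> by (rule \<mu>)
    interpret PZ: prob_space PZ by (rule PZ)
    have "KL_div \<mu> \<mu>0 < \<infinity>"
      using KL by (rule le_less_trans) simp
    then have "absolutely_continuous \<mu>0 \<mu>"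
      by (rule KL_div_finite_imp_absolutely_continuous)
    \<comment> \<open>Only \<open>h\<close> depends on \<mu>; \<open>PZ\<close> and \<open>g\<close>
      were built from \<mu>0 and \<open>Q\<close> alone and thus serve the whole ball.\<close>
    then obtain h where h: "h \<in> borel_measurable \<mu>0" "\<And>x. 0 \<le> h x" "\<mu> = density \<mu>0 (\<lambda>x. ennreal (h x))"
      using ex_real_density[OF \<mu> \<mu>0] sets_\<mu> sets_\<mu>0 by metis
    have h': "h \<in> borel_measurable borel"
      using h(1) unfolding measurable_cong_sets[OF sets_\<mu>0 refl] .
    note density = \<mu> h' h(2) h(3)
    have sets_\<mu>PZ: "sets (\<mu> \<Otimes>\<^sub>M PZ) = sets (borel \<Otimes>\<^sub>M PZ)"
      by (rule sets_pair_measure_cong[OF sets_\<mu> refl])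
    have pair: "(\<lambda>(x, z). (x, g x z)) \<in> \<mu> \<Otimes>\<^sub>M PZ \<rightarrow>\<^sub>M borel \<Otimes>\<^sub>M borel"
      unfolding measurable_cong_sets[OF sets_\<mu>PZ refl] split_beta'
      using g by (intro measurable_Pair) (simp_all add: split_beta')
    show "distr (\<mu> \<Otimes>\<^sub>M PZ) (borel \<Otimes>\<^sub>M borel) (\<lambda>(x, z). (x, g x z)) = joint_law \<mu> Q"
    proof (rule measure_eqI)
      fix A assume "A \<in> sets (distr (\<mu> \<Otimes>\<^sub>M PZ) (borel \<Otimes>\<^sub>M borel) (\<lambda>(x, z). (x, g x z)))"
      then have A: "A \<in> sets (borel \<Otimes>\<^sub>M borel)"
        by simp
      then have A': "A \<in> sets (joint_law \<mu> Q)"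
        by (simp add: sets_joint_law[OF \<mu> sets_\<mu>])
      have ind: "indicator A \<in> borel_measurable (borel \<Otimes>\<^sub>M borel)"
        using A by (rule borel_measurable_indicator)
      have ind_w: "(\<lambda>w. indicator A (x, outcome x w)) \<in> borel_measurable (sample_space \<nu>)" for x
        using measurable_compose[OF measurable_Pair1' outcome_measurable, of x]
        by (intro measurable_compose[OF _ ind] measurable_Pair) simp_all
      have "emeasure (distr (\<mu> \<Otimes>\<^sub>M PZ) (borel \<Otimes>\<^sub>M borel) (\<lambda>(x, z). (x, g x z))) A =
          (\<integral>\<^sup>+p. indicator A p \<partial>distr (\<mu> \<Otimes>\<^sub>M PZ) (borel \<Otimes>\<^sub>M borel) (\<lambda>(x, z). (x, g x z)))"
        using A by (simp del: emeasure_distr)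
      also have "\<dots> = (\<integral>\<^sup>+p. indicator A ((\<lambda>(x, z). (x, g x z)) p) \<partial>(\<mu> \<Otimes>\<^sub>M PZ))"
        using ind by (intro nn_integral_distr[OF pair]) simp
      also have "\<dots> = (\<integral>\<^sup>+x. (\<integral>\<^sup>+z. indicator A (x, g x z) \<partial>PZ) \<partial>\<mu>)"
        using PZ.nn_integral_fst[OF measurable_compose[OF pair ind]] by simp
      also have "\<dots> = (\<integral>\<^sup>+x. (\<integral>\<^sup>+w. indicator A (x, outcome x w) \<partial>sample_space \<nu>) \<partial>\<mu>)"
        unfolding g_def by (intro nn_integral_cong nn_integral_PZ[OF ind_w])
      also have "\<dots> = (\<integral>\<^sup>+p. indicator A p \<partial>joint_law \<mu> Q)"
        by (rule nn_integral_outcome[OF density ind])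
      also have "\<dots> = emeasure (joint_law \<mu> Q) A"
        by (rule nn_integral_indicator[OF A'])
      finally show "emeasure (distr (\<mu> \<Otimes>\<^sub>M PZ) (borel \<Otimes>\<^sub>M borel) (\<lambda>(x, z). (x, g x z))) A = emeasure (joint_law \<mu> Q) A" .
    qed (simp add: sets_joint_law[OF \<mu> sets_\<mu>])
    let ?K = "sup_mutual_info (KL_ball \<mu>0 \<Gamma>) Q + ennreal \<Gamma>"
    show "cond_entropy_fr \<mu> PZ g \<le> ?K + ennreal (log 2 (enn2real ?K + 1)) + 4"
    \<comment> \<open>If \<open>?K\<close> is infinite the bound is trivial, whatever value
      \<open>enn2real\<close> takes inside the logarithm; otherwise \<open>enn2real\<close> loses
      nothing.\<close>
    proof (cases "?K = \<infinity>")
      case False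
      define C where "C = enn2real ?K"
      define a where "a = 1 / (C + 1)"
      have K: "?K = ennreal C" and C: "0 \<le> C"
        using False by (simp_all add: C_def less_top)
      have a: "0 < a"
        using C by (simp add: a_def)
      have "mutual_info \<mu> Q \<le> sup_mutual_info (KL_ball \<mu>0 \<Gamma>) Q"
        unfolding sup_mutual_info_def by (rule SUP_upper[OF ball])
      then have le: "mutual_info \<mu> Q + KL_div \<mu> \<mu>0 \<le> ennreal C"
        unfolding K[symmetric] using KL by (rule add_mono)
      define E where "E w = (\<integral>\<^sup>+x. ennreal (log 2 (1 / cell_code a (cell x w))) \<partial>\<mu>)" for w
      have E: "E \<in> borel_measurable (sample_space \<nu>)"
        unfolding E_def[abs_def]
        using P.borel_measurable_nn_integral_fst[OF measurable_pair_swap[OF log_cell_code_measurable[OF density]]]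
        by simp
      have "cond_entropy_fr \<mu> PZ g \<le> (\<integral>\<^sup>+z. E (inv \<phi> z) \<partial>PZ)"
        unfolding cond_entropy_fr_def g_def E_def
        by (intro nn_integral_mono disc_entropy_outcome_le[OF density a])
      also have "\<dots> = (\<integral>\<^sup>+w. E w \<partial>sample_space \<nu>)"
        by (rule nn_integral_PZ[OF E])
      also have "\<dots> \<le> ennreal C + ennreal (log 2 (C + 1)) + 4"
        unfolding E_def a_def by (rule nn_integral_log_cell_code_outcome_le[OF density C le])
      finally show ?thesis
        unfolding C_def[symmetric] unfolding K .
    qed (simp add: top_add)
  qed
  with PZ g show ?thesis
    by blast
qed

end
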